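(* For any $0<s<1$, $E_0\in\mathbb{R}$ and $\gamma>0$, there exist $\lambda_{\gamma,s}>0$ and $C>0$ such that $$\sup_{\epsilon>0}\mathbb{E}_\omega\left[\left|\left\langle\delta_x,\left(H^\omega_{\lambda,L}-E_0-i\epsilon\right)^{-1}\delta_y\right\rangle\right|^s\right]\leq C e^{-\gamma\, d(x,y)}$$ for all $\lambda>\lambda_{\gamma,s}$, all vertices $x,y\in V_{\mathcal{B}}$, and all $L$ large enough so that $x,y\in\Lambda_L$.
   Context: Let $K\ge 2$ and $m_0\geq 1$ be integers. $\mathcal{B}=(V_{\mathcal{B}},E_{\mathcal{B}})$ is the infinite tree in which every vertex has exactly $K+1$ neighbours, with a distinguished vertex (root) $0\in V_{\mathcal{B}}$; $d(x,y)$ is the graph distance. For vertices $x,y$, write $y\prec x$ if $d(0,x)=d(0,y)+d(y,x)$ (so $y\prec y$). On $\ell^2(\mathcal{B})=\ell^2(V_{\mathcal{B}})$ define $(\Delta\psi)(x)=\sum_{y:\,d(x,y)=1}\psi(y)$. For $U\subseteq V_{\mathcal{B}}$, $\chi_U$ denotes the orthogonal projection $(\chi_U\psi)(x)=\psi(x)$ if $x\in U$ and $0$ otherwise. Let $J=\{x\in V_{\mathcal{B}}: d(0,x)\in (m_0+1)\mathbb{N}\cup\{0\}\}$, and for $y\in J$ let $P_y=\chi_{\{x:\ d(y,x)\le m_0,\ y\prec x\}}$. Let $\{\omega_y\}_{y\in J}$ be i.i.d. real random variables with common distribution $\rho(x)\,dx$, where $\rho\in L^\infty(\mathbb{R})$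 has compact support; $\mathbb{E}_\omega$ is the corresponding expectation. For $\lambda>0$ set $H^\omega_\lambda=\Delta+\lambda\sum_{y\in J}\omega_yP_y$. For $L\in\mathbb{N}$ let $\Lambda_L=\{y\in V_{\mathcal{B}}: d(0,y)\le L\}$ and $H^\omega_{\lambda,L}=\chi_{\Lambda_L}H^\omega_\lambda\chi_{\Lambda_L}$, regarded as an operator on $\ell^2(\Lambda_L)$. $\delta_x$ is the indicator function of $\{x\}$. The constants $\lambda_{\gamma,s}$ and $C$ do not depend on $x,y,L,\lambda$. *)

theory Defs
  imports "HOL-Probability.Probability"
begin

text \<open>The vertex set is the whole type \<open>'v\<close>; a graph is given by its adjacency relation.\<close>

definition is_cycle :: "('v \<Rightarrow> 'v \<Rightarrow> bool) \<Rightarrow> 'v list \<Rightarrow> bool" where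
  "is_cycle E p \<longleftrightarrow> length p \<ge> 3 \<and> distinct p \<and> successively E p \<and> E (last p) (hd p)"

definition is_tree :: "('v \<Rightarrow> 'v \<Rightarrow> bool) \<Rightarrow> bool" where
  "is_tree E \<longleftrightarrow> symp E \<and> irreflp E \<and> (\<forall>x y. E\<^sup>*\<^sup>* x y) \<and> (\<nexists>p. is_cycle E p)"

definition is_regular :: "('v \<Rightarrow> 'v \<Rightarrow> bool) \<Rightarrow> nat \<Rightarrow> bool" where
  "is_regular E k \<longleftrightarrow> (\<forall>x. finite {y. E x y} \<and> card {y. E x y} = k)"

definition gdist :: "('v \<Rightarrow> 'v \<Rightarrow> bool) \<Rightarrow> 'v \<Rightarrow> 'v \<Rightarrow> nat" where
  "gdist E x y = (LEAST n. (E ^^ n) x y)"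

definition prec :: "('v \<Rightarrow> 'v \<Rightarrow> bool) \<Rightarrow> 'v \<Rightarrow> 'v \<Rightarrow> 'v \<Rightarrow> bool" where
  "prec E r y x \<longleftrightarrow> gdist E r x = gdist E r y + gdist E y x"

text \<open>\<open>ell2 U\<close> is identified with the square-summable functions on all vertices that vanish
  off \<open>U\<close>. The operators below are given by pointwise formulas that make sense for arbitrary
  functions; only their action on \<open>ell2\<close> matters.\<close>

definition ell2 :: "'v set \<Rightarrow> ('v \<Rightarrow> complex) set" where
  "ell2 U = {\<psi>. (\<forall>x. x \<notin> U \<longrightarrow> \<psi> x = 0) \<and> (\<lambda>x. (cmod (\<psi> x))\<^sup>2) summable_on UNIV}"

definition ell2_inner :: "('v \<Rightarrow> complex) \<Rightarrow> ('v \<Rightarrow> complex) \<Rightarrow> complex" where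
  "ell2_inner \<phi> \<psi> = (\<Sum>\<^sub>\<infinity>x. cnj (\<phi> x) * \<psi> x)"

definition delta :: "'v \<Rightarrow> 'v \<Rightarrow> complex" where
  "delta x = (\<lambda>z. if z = x then 1 else 0)"

definition chi :: "'v set \<Rightarrow> ('v \<Rightarrow> complex) \<Rightarrow> 'v \<Rightarrow> complex" where
  "chi U \<psi> = (\<lambda>x. if x \<in> U then \<psi> x else 0)"

definition laplacian :: "('v \<Rightarrow> 'v \<Rightarrow> bool) \<Rightarrow> ('v \<Rightarrow> complex) \<Rightarrow> 'v \<Rightarrow> complex" where
  "laplacian E \<psi> = (\<lambda>x. \<Sum>y | gdist E x y = 1. \<psi> y)"

definition J_set :: "('v \<Rightarrow> 'v \<Rightarrow> bool) \<Rightarrow> 'v \<Rightarrow> nat \<Rightarrow> 'v set" where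
  "J_set E r m0 = {x. (m0 + 1) dvd gdist E r x}"

definition block_proj ::
  "('v \<Rightarrow> 'v \<Rightarrow> bool) \<Rightarrow> 'v \<Rightarrow> nat \<Rightarrow> 'v \<Rightarrow> ('v \<Rightarrow> complex) \<Rightarrow> 'v \<Rightarrow> complex" where
  "block_proj E r m0 y = chi {x. gdist E y x \<le> m0 \<and> prec E r y x}"

text \<open>The sum over \<open>J\<close> of the operators \<open>\<omega>\<^sub>y P\<^sub>y\<close> is taken pointwise (strongly); at every vertex
  of a tree exactly one term involves \<open>\<psi> x\<close>.\<close>

definition hamiltonian ::
  "('v \<Rightarrow> 'v \<Rightarrow> bool) \<Rightarrow> 'v \<Rightarrow> nat \<Rightarrow> ('v \<Rightarrow> real) \<Rightarrow> real \<Rightarrow> ('v \<Rightarrow> complex) \<Rightarrow> 'v \<Rightarrow> complex" where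
  "hamiltonian E r m0 w lam \<psi> =
     (\<lambda>x. laplacian E \<psi> x +
        complex_of_real lam *
          (\<Sum>\<^sub>\<infinity>y\<in>J_set E r m0. complex_of_real (w y) * block_proj E r m0 y \<psi> x))"

definition Lambda_box :: "('v \<Rightarrow> 'v \<Rightarrow> bool) \<Rightarrow> 'v \<Rightarrow> nat \<Rightarrow> 'v set" where
  "Lambda_box E r L = {y. gdist E r y \<le> L}"

definition hamiltonian_box ::
  "('v \<Rightarrow> 'v \<Rightarrow> bool) \<Rightarrow> 'v \<Rightarrow> nat \<Rightarrow> ('v \<Rightarrow> real) \<Rightarrow> real \<Rightarrow> nat \<Rightarrow> ('v \<Rightarrow> complex) \<Rightarrow> 'v \<Rightarrow> complex"
  where
  "hamiltonian_box E r m0 w lam L \<psi> =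
     chi (Lambda_box E r L) (hamiltonian E r m0 w lam (chi (Lambda_box E r L) \<psi>))"

text \<open>The inverse of \<open>A - z\<close> as an operator on \<open>ell2 U\<close>. It is meaningful when \<open>A - z\<close> maps
  \<open>ell2 U\<close> bijectively to itself, e.g. for \<open>A\<close> self-adjoint on \<open>ell2 U\<close> and \<open>z\<close> non-real.\<close>

definition resolvent_on ::
  "'v set \<Rightarrow> (('v \<Rightarrow> complex) \<Rightarrow> 'v \<Rightarrow> complex) \<Rightarrow> complex \<Rightarrow> ('v \<Rightarrow> complex) \<Rightarrow> 'v \<Rightarrow> complex" where
  "resolvent_on U A z = inv_into (ell2 U) (\<lambda>\<psi> x. A \<psi> x - z * \<psi> x)"

end

theory Submission
  imports Defs "HOL-Complex_Analysis.Cauchy_Integral_Theorem"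
begin

text \<open>Fix a vertex \<open>x\<close> in the block \<open>W\<close> of \<open>u\<close>. The geometric resolvent identity
  \<open>G\<^sub>S(x, y) = - \<Sum> G\<^sub>S(x, b) G\<^bsub>S - W\<^esub>(a, y)\<close>, summed over the edges from \<open>b \<in> W\<close> to \<open>a \<in> S - W\<close>, has a second
  factor that does not depend on \<open>\<omega>\<^sub>u\<close>. As a function of \<open>\<omega>\<^sub>u\<close>, the first factor is a combination
  of Herglotz functions of size at most \<open>9 / (\<lambda> \<bar>Im \<zeta>\<bar>)\<close> at complex coupling \<open>\<zeta>\<close>, so the \<open>\<omega>\<^sub>u\<close>-average of
  its \<open>s\<close>-th moment is \<open>O(\<lambda>\<^bsup>-s\<^esup>)\<close>. Blocks have bounded diameter and boundary, so iterating over
  blocks gives exponential decay at any rate once \<open>\<lambda>\<close> is large.\<close>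

section \<open>Fractional moments of Herglotz functions\<close>

text \<open>As a function of one real coupling, a Green's function can have poles arbitrarily close
  to the real axis as \<epsilon> tends to 0. A singularity 1 / |t - t0| is integrable only to a
  power s < 1, whence fractional moments. An off-diagonal entry is not Herglotz itself, but
  polarization writes it through four quadratic forms that are. Their size is controlled off the
  axis only: a coupling with negative imaginary part adds the absorption \<lambda> |Im \<zeta>| on
  the block. Both arguments of the first factor lie in that block, so this absorption alone bounds
  it, whatever \<epsilon>, the energy, the box and the other couplings are. The first factor still
  depends on all the couplings; the uniformity of its bound is what lets \<omega>_u be integrated
  first with the second factor frozen.\<close>

lemma powr_add_le:
  fixes a b s :: real
  assumes "0 \<le> a" "0 \<le> b" "0 < s" "s \<le> 1"
  shows "(a + b) powr s \<le> a powr s + b powr s"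
proof (cases "a + b = 0")
  case False
  with assms have p: "0 < a + b" by simp
  have le: "t * (a + b) powr s \<le> (t * (a + b)) powr s" if "0 \<le> t" "t \<le> 1" for t
  proof -
    have "t \<le> t powr s"
      using powr_mono'[of s 1 t] that assms by (cases "t = 0") auto
    then show ?thesis
      using that p by (simp add: powr_mult mult_right_mono)
  qed
  have "(a + b) powr s = (a / (a+b) + b / (a+b)) * (a + b) powr s"
    using p by (simp add: field_simps flip: add_divide_distrib)
  also have "\<dots> \<le> (a / (a+b) * (a+b)) powr s + (b / (a+b) * (a+b)) powr s"
    unfolding distrib_right using assms p by (intro add_mono le) (auto simp: field_simps)
  finally show ?thesis using p by simp
qed (use assms in simp)

lemma powr_sum_le:
  fixes f :: "'a \<Rightarrow> real"
  assumes "\<And>i. i \<in> I \<Longrightarrow> 0 \<le> f i" "0 < s" "s \<le> 1"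
  shows "(\<Sum>i\<in>I. f i) powr s \<le> (\<Sum>i\<in>I. f i powr s)"
proof (cases "finite I")
  case True
  then show ?thesis using assms(1)
  proof induction
    case (insert i I)
    have "(\<Sum>i\<in>insert i I. f i) powr s \<le> f i powr s + (\<Sum>i\<in>I. f i) powr s"
      using insert assms by (simp add: powr_add_le sum_nonneg)
    then show ?case using insert by fastforce
  qed simp
qed simp

lemma cos_half_pi_mult_pos:
  fixes s :: real
  assumes "0 < s" "s < 1"
  shows "0 < cos (pi / 2 * s)"
proof (rule cos_gt_zero_pi)
  have "0 < pi / 2 * s" "pi / 2 * s < pi / 2 * 1"
    using assms by (simp, intro mult_strict_left_mono) auto
  then show "- (pi / 2) < pi / 2 * s" "pi / 2 * s < pi / 2"
    using pi_gt_zero by linarith+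
qed

text \<open>The branch of \<open>(- \<i> \<Phi>)\<^sup>s\<close> is holomorphic and its real part dominates \<open>\<bar>\<Phi>\<bar>\<^sup>s\<close>. Cauchy's theorem on the
  rectangle below \<open>[-T, T]\<close> reduces the integral to the other three sides, where the bound on
  \<open>\<Phi>\<close> gives the integrable singularity \<open>\<tau>\<^bsup>-s\<^esup>\<close>.\<close>

lemma Herglotz_fractional_moment:
  fixes \<Phi> :: "complex \<Rightarrow> complex"
  assumes hol: "\<Phi> holomorphic_on {\<zeta>. Im \<zeta> < \<delta>}" and "0 < \<delta>"
    and pos: "\<And>\<zeta>. Im \<zeta> < \<delta> \<Longrightarrow> 0 < Im (\<Phi> \<zeta>)"
    and bd: "\<And>\<zeta>. Im \<zeta> < 0 \<Longrightarrow> cmod (\<Phi> \<zeta>) \<le> c / (- Im \<zeta>)"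
    and s: "0 < s" "s < 1" and T: "0 < T" and c: "0 < c"
  shows "(\<integral>\<^sup>+ t. ennreal (cmod (\<Phi> (of_real t)) powr s) * indicator {-T..T} t \<partial>lborel)
    \<le> ennreal (c powr s * (2 * T + 2 / (1 - s)) / cos (pi / 2 * s))"
proof -
  let ?H = "{\<zeta>. Im \<zeta> < \<delta>}"
  define h where "h \<zeta> = exp (of_real s * Ln (- \<i> * \<Phi> \<zeta>))" for \<zeta>
  have nz: "- \<i> * \<Phi> \<zeta> \<notin> \<real>\<^sub>\<le>\<^sub>0" "\<Phi> \<zeta> \<noteq> 0" if "Im \<zeta> < \<delta>" for \<zeta>
    using pos[OF that] by (auto simp: complex_nonpos_Reals_iff)
  have h_hol: "h holomorphic_on ?H"
    unfolding h_def by (intro holomorphic_intros hol) (use nz in auto)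
  have cos_pos: "0 < cos (pi / 2 * s)" using s by (rule cos_half_pi_mult_pos)
  have norm_h: "cmod (h \<zeta>) = cmod (\<Phi> \<zeta>) powr s" if "Im \<zeta> < \<delta>" for \<zeta>
    using nz[OF that] by (simp add: h_def norm_exp_eq_Re powr_def norm_mult)
  \<comment> \<open>\<open>- \<i> * \<Phi> \<zeta>\<close> lies in the open right half-plane, so its
    argument is below pi / 2 in modulus and that of its s-th power \<open>h \<zeta>\<close> is at
    most pi s / 2.\<close>
  have Re_h: "cos (pi / 2 * s) * cmod (\<Phi> \<zeta>) powr s \<le> Re (h \<zeta>)" if "Im \<zeta> < \<delta>" for \<zeta>
  proof -
    let ?l = "Ln (- \<i> * \<Phi> \<zeta>)"
    have "0 < Re (- \<i> * \<Phi> \<zeta>)" using pos[OF that] by simp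
    then have "\<bar>Im ?l\<bar> < pi / 2" by (rule Re_Ln_pos_lt_imp)
    then have "\<bar>s * Im ?l\<bar> \<le> pi / 2 * s" using s by (simp add: abs_mult mult.commute)
    then have "cos (pi / 2 * s) \<le> cos \<bar>s * Im ?l\<bar>"
    proof (intro cos_monotone_0_pi_le)
      have "pi / 2 * s \<le> pi / 2 * 1" using s by (intro mult_left_mono) auto
      then show "pi / 2 * s \<le> pi" using pi_gt_zero by linarith
    qed simp
    moreover have "Re (h \<zeta>) = cmod (h \<zeta>) * cos (s * Im ?l)"
      by (simp add: h_def Re_exp norm_exp_eq_Re)
    ultimately show ?thesis using norm_h[OF that] by (simp add: mult.commute mult_left_mono)
  qed
  have op: "open ?H" by (rule open_halfspace_Im_lt)
  \<comment> \<open>Cauchy's theorem enters through a primitive on the half-plane: every side of the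
    rectangle becomes a difference of values of \<open>G\<close>.\<close>
  obtain G where "\<And>\<zeta>. \<zeta> \<in> ?H \<Longrightarrow> (G has_field_derivative h \<zeta>) (at \<zeta> within ?H)"
    using holomorphic_convex_primitive'[OF convex_halfspace_Im_lt op h_hol] by blast
  then have G: "(G has_field_derivative h \<zeta>) (at \<zeta>)" if "Im \<zeta> < \<delta>" for \<zeta>
    using that at_within_open[OF _ op] by (metis mem_Collect_eq)
  have side: "cmod (G (Complex a 0) - G (Complex a (-1))) \<le> c powr s / (1 - s)" for a
  proof -
    \<comment> \<open>\<open>?g\<close> is a primitive of the majorant of |h| at depth \<tau>. It is
      continuous at 0 because s < 1, although its derivative blows up there; the mean value bound
      asks for derivatives only inside the interval.\<close>
    let ?f = "\<lambda>\<tau>. G (Complex a (-\<tau>))" and ?g = "\<lambda>\<tau>. c powr s * \<tau> powr (1 - s) / (1 - s)"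
    have df: "(?f has_vector_derivative (- \<i> * h (Complex a (-\<tau>)))) (at \<tau>)" if "\<tau> \<ge> 0" for \<tau>
    proof -
      have "((\<lambda>\<tau>. Complex a (-\<tau>)) has_vector_derivative (- \<i>)) (at \<tau>)"
        unfolding Complex_eq by (auto intro!: derivative_eq_intros)
      from field_vector_diff_chain_at[OF this G] show ?thesis
        using that \<open>0 < \<delta>\<close> by (simp add: o_def)
    qed
    have dg: "(?g has_vector_derivative c powr s * \<tau> powr (- s)) (at \<tau>)" if "\<tau> > 0" for \<tau>
      unfolding has_real_derivative_iff_has_vector_derivative[symmetric]
      by (rule derivative_eq_intros refl | use that s in simp)+
    have "cmod (?f 1 - ?f 0) \<le> ?g 1 - ?g 0"
    proof (rule differentiable_bound_general)
      show "continuous_on {0..1} ?f"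
        by (auto intro!: continuous_at_imp_continuous_on has_vector_derivative_continuous df)
      show "continuous_on {0..1} ?g"
        using s by (intro continuous_intros continuous_on_powr') auto
      fix \<tau> :: real assume \<tau>: "0 < \<tau>" "\<tau> < 1"
      show "(?f has_vector_derivative (- \<i> * h (Complex a (-\<tau>)))) (at \<tau>)" using df \<tau> by simp
      show "(?g has_vector_derivative c powr s * \<tau> powr (- s)) (at \<tau>)" using dg \<tau> by simp
      have "cmod (\<Phi> (Complex a (-\<tau>))) powr s \<le> (c / \<tau>) powr s"
        using bd[of "Complex a (-\<tau>)"] \<tau> s by (intro powr_mono2) auto
      then show "cmod (- \<i> * h (Complex a (-\<tau>))) \<le> c powr s * \<tau> powr (- s)"
        using \<tau> \<open>0 < \<delta>\<close> c by (simp add: norm_mult norm_h powr_divide powr_minus_divide)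
    qed simp
    then show ?thesis using s by (simp add: norm_minus_commute)
  qed
  have bottom: "cmod (G (Complex T (-1)) - G (Complex (-T) (-1))) \<le> c powr s * (2 * T)"
  proof -
    have "cmod (G (Complex T (-1)) - G (Complex (-T) (-1)))
        \<le> c powr s * cmod (Complex T (-1) - Complex (-T) (-1))"
    proof (rule field_differentiable_bound)
      show "convex {\<zeta>. Im \<zeta> = -1}" by (auto simp: convex_def algebra_simps)
      fix \<zeta> assume "\<zeta> \<in> {\<zeta>. Im \<zeta> = -1}"
      then have \<zeta>: "Im \<zeta> = -1" by simp
      then show "(G has_field_derivative h \<zeta>) (at \<zeta> within {\<zeta>. Im \<zeta> = -1})"
        using G[of \<zeta>] \<open>0 < \<delta>\<close> has_field_derivative_at_within by simp
      show "cmod (h \<zeta>) \<le> c powr s"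
        using norm_h[of \<zeta>] bd[of \<zeta>] \<zeta> \<open>0 < \<delta>\<close> s by (auto intro: powr_mono2)
    qed auto
    also have "Complex T (-1) - Complex (-T) (-1) = of_real (2 * T)"
      by (simp add: complex_eq_iff)
    finally show ?thesis using T by (simp only: norm_of_real)
  qed
  \<comment> \<open>The two vertical sides cost \<open>1 / (1 - s)\<close> each; the bottom side has
    length \<open>2 * T\<close> and lies at depth 1, where |\<Phi>| is at most
    \<open>c\<close>.\<close>
  have top: "cmod (G (of_real T) - G (of_real (-T))) \<le> c powr s * (2 * T + 2 / (1 - s))"
  proof -
    have "G (of_real T) - G (of_real (-T))
      = (G (Complex T 0) - G (Complex T (-1))) + (G (Complex T (-1)) - G (Complex (-T) (-1)))
        - (G (Complex (-T) 0) - G (Complex (-T) (-1)))"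
      by (simp add: complex_of_real_def)
    moreover have "cmod (u + v - w) \<le> cmod u + cmod v + cmod w" for u v w :: complex
      using norm_triangle_ineq4[of "u + v" w] norm_triangle_ineq[of u v] by linarith
    ultimately have "cmod (G (of_real T) - G (of_real (-T)))
      \<le> c powr s / (1 - s) + c powr s * (2 * T) + c powr s / (1 - s)"
      using side[of T] side[of "-T"] bottom by (smt (verit))
    then show ?thesis by (simp add: algebra_simps)
  qed
  have cont: "continuous_on UNIV (\<lambda>t. h (complex_of_real t))"
    by (rule continuous_on_compose2[OF holomorphic_on_imp_continuous_on[OF h_hol]])
       (use \<open>0 < \<delta>\<close> in \<open>auto intro!: continuous_intros\<close>)
  have meas: "(\<lambda>t. Re (h (complex_of_real t))) \<in> borel_measurable borel"
    by (intro borel_measurable_continuous_onI continuous_intros cont)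
  have "(\<integral>\<^sup>+ t. ennreal (cmod (\<Phi> (of_real t)) powr s) * indicator {-T..T} t \<partial>lborel)
    \<le> (\<integral>\<^sup>+ t. ennreal (1 / cos (pi / 2 * s)) * (ennreal (Re (h (of_real t))) * indicator {-T..T} t) \<partial>lborel)"
  proof (rule nn_integral_mono)
    fix t :: real
    have "cmod (\<Phi> (of_real t)) powr s \<le> 1 / cos (pi / 2 * s) * Re (h (of_real t))"
      using Re_h[of "of_real t"] cos_pos \<open>0 < \<delta>\<close> by (simp add: field_simps)
    then show "ennreal (cmod (\<Phi> (of_real t)) powr s) * indicator {-T..T} t
      \<le> ennreal (1 / cos (pi / 2 * s)) * (ennreal (Re (h (of_real t))) * indicator {-T..T} t)"
      using cos_pos by (auto simp: ennreal_mult'[symmetric] ennreal_leI split: split_indicator)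
  qed
  also have "\<dots> = ennreal (1 / cos (pi / 2 * s)) *
      (\<integral>\<^sup>+ t. ennreal (Re (h (of_real t))) * indicator {-T..T} t \<partial>lborel)"
    using meas by (intro nn_integral_cmult) simp
  also have "(\<integral>\<^sup>+ t. ennreal (Re (h (of_real t))) * indicator {-T..T} t \<partial>lborel)
      = ennreal (Re (G (of_real T)) - Re (G (of_real (-T))))"
  proof (rule nn_integral_FTC_Icc)
    fix t :: real
    have "((\<lambda>t. G (complex_of_real t)) has_vector_derivative h (of_real t)) (at t)"
      using has_vector_derivative_real_field[OF G[of "of_real t"]] \<open>0 < \<delta>\<close> by simp
    then have "((\<lambda>t. Re (G (complex_of_real t))) has_vector_derivative Re (h (of_real t))) (at t)"
      by (rule bounded_linear.has_vector_derivative[OF bounded_linear_Re])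
    then show "((\<lambda>t. Re (G (complex_of_real t))) has_real_derivative Re (h (of_real t))) (at t)"
      by (simp add: has_real_derivative_iff_has_vector_derivative)
    have "0 \<le> cos (pi / 2 * s) * cmod (\<Phi> (of_real t)) powr s" using cos_pos by simp
    also have "\<dots> \<le> Re (h (of_real t))" using \<open>0 < \<delta>\<close> by (intro Re_h) simp
    finally show "0 \<le> Re (h (of_real t))" .
  qed (use T meas in auto)
  also have "ennreal (1 / cos (pi / 2 * s)) * \<dots> \<le>
      ennreal (c powr s * (2 * T + 2 / (1 - s)) / cos (pi / 2 * s))"
  proof -
    have "Re (G (of_real T)) - Re (G (of_real (-T))) \<le> c powr s * (2 * T + 2 / (1 - s))"
      using top complex_Re_le_cmod[of "G (of_real T) - G (of_real (-T))"] by simp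
    then have "1 / cos (pi / 2 * s) * (Re (G (of_real T)) - Re (G (of_real (-T))))
       \<le> 1 / cos (pi / 2 * s) * (c powr s * (2 * T + 2 / (1 - s)))"
      using cos_pos by (intro mult_left_mono) auto
    then show ?thesis using cos_pos by (simp add: ennreal_mult'[symmetric] ennreal_leI)
  qed
  finally show ?thesis .
qed

section \<open>Green's functions of finite matrices\<close>

text \<open>The Green's function of the matrix \<open>M\<close> restricted to the vertices in the list, built up by
  adding one vertex at a time and taking Schur complements. Being an explicit rational expression,
  it is measurable and holomorphic in any parameter on which the entries of \<open>M\<close> so depend.\<close>

fun green :: "('v \<Rightarrow> 'v \<Rightarrow> complex) \<Rightarrow> 'v list \<Rightarrow> 'v \<Rightarrow> 'v \<Rightarrow> complex" where
  "green M [] x y = 0"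
| "green M (a # xs) x y = green M xs x y +
     (if x = a then 1 else - (\<Sum>b\<in>set xs. green M xs x b * M b a)) *
     inverse (M a a - (\<Sum>b\<in>set xs. \<Sum>c\<in>set xs. M a b * (green M xs b c * M c a))) *
     (if y = a then 1 else - (\<Sum>b\<in>set xs. M a b * green M xs b y))"

lemma green_outside: "x \<notin> set xs \<or> y \<notin> set xs \<Longrightarrow> green M xs x y = 0"
proof (induction xs arbitrary: x y)
  case (Cons a xs)
  then have "green M xs x y = 0" by auto
  moreover have "green M xs x b = 0" if "x \<notin> set (a # xs)" for b using that Cons.IH by auto
  moreover have "green M xs b y = 0" if "y \<notin> set (a # xs)" for b using that Cons.IH by auto
  ultimately show ?case using Cons.prems by (cases "x \<in> set (a # xs)") auto
qed simp

lemma green_cong: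
  assumes "\<And>x y. x \<in> set xs \<Longrightarrow> y \<in> set xs \<Longrightarrow> M x y = M' x y"
  shows "green M xs x y = green M' xs x y"
  using assms
proof (induction xs arbitrary: x y)
  case (Cons a xs)
  have *: "green M xs = green M' xs" using Cons by (intro ext) simp
  show ?case by (simp add: * Cons.prems)
qed simp

lemma measurable_green:
  assumes "\<And>x y. x \<in> set xs \<Longrightarrow> y \<in> set xs \<Longrightarrow> (\<lambda>w. M w x y) \<in> borel_measurable N"
  shows "(\<lambda>w. green (M w) xs x y) \<in> borel_measurable N"
  using assms
proof (induction xs arbitrary: x y)
  case (Cons a xs)
  have [measurable]: "(\<lambda>w. green (M w) xs x y) \<in> borel_measurable N" for x y
    using Cons by simp
  have [measurable]: "(\<lambda>w. M w x y) \<in> borel_measurable N"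
    if "x \<in> insert a (set xs)" "y \<in> insert a (set xs)" for x y
    using Cons.prems that by simp
  have l: "(\<lambda>w. if x = a then 1 else - (\<Sum>b\<in>set xs. green (M w) xs x b * M w b a)) \<in> borel_measurable N"
    by (cases "x = a") simp_all
  have r: "(\<lambda>w. if y = a then 1 else - (\<Sum>b\<in>set xs. M w a b * green (M w) xs b y)) \<in> borel_measurable N"
    by (cases "y = a") simp_all
  show ?case unfolding green.simps
    by (intro borel_measurable_add borel_measurable_times l r) measurable
qed simp

text \<open>Quantifying over all subsets \<open>T\<close> makes every principal submatrix injective,
  so elimination meets no zero pivot in whatever order the vertices are listed.\<close>

definition nondegenerate :: "('v \<Rightarrow> 'v \<Rightarrow> complex) \<Rightarrow> 'v set \<Rightarrow> bool" where
  "nondegenerate M S \<longleftrightarrow> (\<forall>T\<subseteq>S. \<forall>\<psi>. (\<forall>x\<in>T. (\<Sum>z\<in>T. M x z * \<psi> z) = 0) \<longrightarrow> (\<forall>x\<in>T. \<psi> x = 0))"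

lemma nondegenerate_subset: "nondegenerate M S \<Longrightarrow> T \<subseteq> S \<Longrightarrow> nondegenerate M T"
  unfolding nondegenerate_def by (meson order_trans)

lemma nondegenerateD:
  "nondegenerate M S \<Longrightarrow> (\<And>x. x \<in> S \<Longrightarrow> (\<Sum>z\<in>S. M x z * \<psi> z) = 0) \<Longrightarrow> x \<in> S \<Longrightarrow> \<psi> x = 0"
  unfolding nondegenerate_def by blast

text \<open>The vector \<open>l\<close>, extending the value 1 at \<open>a\<close>, is annihilated
  by every row of \<open>M\<close> except row \<open>a\<close>, where the product is the pivot. A
  zero pivot would make \<open>l\<close> a nonzero null vector; with a nonzero pivot, a multiple of
  \<open>l\<close> repairs row \<open>a\<close> and leaves the other rows unchanged.\<close>

lemma green_right_inverse_and_pivot: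
  assumes "distinct (a # xs)" "nondegenerate M (set (a # xs))"
    and IH: "\<And>x y. x \<in> set xs \<Longrightarrow> y \<in> set xs \<Longrightarrow>
      (\<Sum>z\<in>set xs. M x z * green M xs z y) = (if x = y then 1 else 0)"
  shows "M a a - (\<Sum>b\<in>set xs. \<Sum>c\<in>set xs. M a b * (green M xs b c * M c a)) \<noteq> 0" (is "?D \<noteq> 0")
    and "x \<in> set (a # xs) \<Longrightarrow> y \<in> set (a # xs) \<Longrightarrow>
      (\<Sum>z\<in>set (a # xs). M x z * green M (a # xs) z y) = (if x = y then 1 else 0)"
proof -
  have a: "a \<notin> set xs" using assms by simp
  define l where "l x = (if x = a then 1 else - (\<Sum>b\<in>set xs. green M xs x b * M b a))" for x
  have Ml: "(\<Sum>z\<in>set (a # xs). M x z * l z) = (if x = a then ?D else 0)" if x: "x \<in> set (a # xs)" for x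
  proof -
    have "(\<Sum>z\<in>set (a # xs). M x z * l z) = M x a + (\<Sum>z\<in>set xs. M x z * l z)"
      using a by (simp add: l_def)
    also have "(\<Sum>z\<in>set xs. M x z * l z) = (\<Sum>z\<in>set xs. - (\<Sum>b\<in>set xs. M x z * (green M xs z b * M b a)))"
      using a by (intro sum.cong refl) (auto simp: l_def sum_distrib_left)
    also have "\<dots> = - (\<Sum>z\<in>set xs. \<Sum>b\<in>set xs. M x z * (green M xs z b * M b a))"
      by (simp add: sum_negf)
    finally have eq: "(\<Sum>z\<in>set (a # xs). M x z * l z)
      = M x a - (\<Sum>z\<in>set xs. \<Sum>b\<in>set xs. M x z * (green M xs z b * M b a))" by simp
    show ?thesis
    proof (cases "x = a")
      case False
      then have xs: "x \<in> set xs" using x by simp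
      have "(\<Sum>z\<in>set xs. \<Sum>b\<in>set xs. M x z * (green M xs z b * M b a))
        = (\<Sum>b\<in>set xs. (\<Sum>z\<in>set xs. M x z * green M xs z b) * M b a)"
        by (subst sum.swap) (simp add: sum_distrib_right mult.assoc)
      also have "\<dots> = (\<Sum>b\<in>set xs. if x = b then M b a else 0)"
        using IH[OF xs] by (intro sum.cong) auto
      finally show ?thesis using eq xs False by simp
    qed (use eq in simp)
  qed
  show D: "?D \<noteq> 0"
  proof
    assume "?D = 0"
    then have "l a = 0"
      using Ml nondegenerateD[OF assms(2), of l a] by auto
    then show False by (simp add: l_def)
  qed
  assume x: "x \<in> set (a # xs)" and y: "y \<in> set (a # xs)"
  define r where "r = (if y = a then 1 else - (\<Sum>b\<in>set xs. M a b * green M xs b y))"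
  have "(\<Sum>z\<in>set (a # xs). M x z * green M (a # xs) z y)
    = (\<Sum>z\<in>set (a # xs). M x z * green M xs z y) + (\<Sum>z\<in>set (a # xs). M x z * l z) * (inverse ?D * r)"
    by (simp only: green.simps l_def[symmetric] r_def[symmetric] distrib_left sum.distrib
        sum_distrib_right mult.assoc)
  also have "(\<Sum>z\<in>set (a # xs). M x z * green M xs z y) = (\<Sum>z\<in>set xs. M x z * green M xs z y)"
    using a by (simp add: green_outside)
  also have "\<dots> + (\<Sum>z\<in>set (a # xs). M x z * l z) * (inverse ?D * r) = (if x = y then 1 else 0)"
  proof (cases "x = a")
    case True
    then have "(\<Sum>z\<in>set (a # xs). M x z * l z) * (inverse ?D * r) = r"
      using D Ml[OF x] by simp
    then show ?thesis using True a by (cases "y = a") (auto simp: r_def green_outside)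
  next
    case False
    then have "(\<Sum>z\<in>set xs. M x z * green M xs z y) = (if x = y then 1 else 0)"
      using IH x y a by (cases "y = a") (auto simp: green_outside)
    then show ?thesis using False Ml[OF x] by simp
  qed
  finally show "(\<Sum>z\<in>set (a # xs). M x z * green M (a # xs) z y) = (if x = y then 1 else 0)" .
qed

lemma green_right_inverse:
  assumes "distinct xs" "nondegenerate M (set xs)" "x \<in> set xs" "y \<in> set xs"
  shows "(\<Sum>z\<in>set xs. M x z * green M xs z y) = (if x = y then 1 else 0)"
  using assms
proof (induction xs arbitrary: x y)
  case (Cons a xs)
  have "nondegenerate M (set xs)"
    using Cons.prems(2) by (rule nondegenerate_subset) auto
  then show ?case
    using Cons by (intro green_right_inverse_and_pivot(2)) auto
qed simp

lemma green_pivot_nonzero: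
  assumes "distinct (a # xs)" "nondegenerate M (set (a # xs))"
  shows "M a a - (\<Sum>b\<in>set xs. \<Sum>c\<in>set xs. M a b * (green M xs b c * M c a)) \<noteq> 0"
proof (rule green_right_inverse_and_pivot(1)[OF assms])
  have "nondegenerate M (set xs)"
    using assms(2) by (rule nondegenerate_subset) auto
  then show "(\<Sum>z\<in>set xs. M x z * green M xs z y) = (if x = y then 1 else 0)"
    if "x \<in> set xs" "y \<in> set xs" for x y
    using assms that by (intro green_right_inverse) auto
qed

lemma holomorphic_on_green:
  assumes "distinct xs" "\<And>\<zeta>. \<zeta> \<in> U \<Longrightarrow> nondegenerate (M \<zeta>) (set xs)"
    and "\<And>x y. x \<in> set xs \<Longrightarrow> y \<in> set xs \<Longrightarrow> (\<lambda>\<zeta>. M \<zeta> x y) holomorphic_on U"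
  shows "(\<lambda>\<zeta>. green (M \<zeta>) xs x y) holomorphic_on U"
  using assms
proof (induction xs arbitrary: x y)
  case (Cons a xs)
  have nd: "nondegenerate (M \<zeta>) (set xs)" if "\<zeta> \<in> U" for \<zeta>
    using Cons.prems(2)[OF that] by (rule nondegenerate_subset) auto
  have g: "(\<lambda>\<zeta>. green (M \<zeta>) xs x y) holomorphic_on U" for x y
    using Cons nd by simp
  have m: "(\<lambda>\<zeta>. M \<zeta> x y) holomorphic_on U" if "x \<in> set (a # xs)" "y \<in> set (a # xs)" for x y
    using Cons.prems(3) that by simp
  have D: "(\<lambda>\<zeta>. inverse (M \<zeta> a a - (\<Sum>b\<in>set xs. \<Sum>c\<in>set xs. M \<zeta> a b * (green (M \<zeta>) xs b c * M \<zeta> c a))))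
    holomorphic_on U"
  proof (intro holomorphic_on_inverse holomorphic_on_diff holomorphic_on_sum holomorphic_on_mult g m)
    fix \<zeta> assume "\<zeta> \<in> U"
    then show "M \<zeta> a a - (\<Sum>b\<in>set xs. \<Sum>c\<in>set xs. M \<zeta> a b * (green (M \<zeta>) xs b c * M \<zeta> c a)) \<noteq> 0"
      using Cons.prems by (intro green_pivot_nonzero) auto
  qed auto
  have l: "(\<lambda>\<zeta>. if x = a then 1 else - (\<Sum>b\<in>set xs. green (M \<zeta>) xs x b * M \<zeta> b a)) holomorphic_on U"
    by (cases "x = a") (auto intro!: holomorphic_on_minus holomorphic_on_sum holomorphic_on_mult g m)
  have r: "(\<lambda>\<zeta>. if y = a then 1 else - (\<Sum>b\<in>set xs. M \<zeta> a b * green (M \<zeta>) xs b y)) holomorphic_on U"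
    by (cases "y = a") (auto intro!: holomorphic_on_minus holomorphic_on_sum holomorphic_on_mult g m)
  show ?case unfolding green.simps
    by (intro holomorphic_on_add holomorphic_on_mult g D l r)
qed simp

lemma green_solves:
  assumes "distinct xs" "nondegenerate M (set xs)" "x \<in> set xs"
  shows "(\<Sum>z\<in>set xs. M x z * (\<Sum>y\<in>set xs. green M xs z y * \<phi> y)) = \<phi> x"
proof -
  have "(\<Sum>z\<in>set xs. M x z * (\<Sum>y\<in>set xs. green M xs z y * \<phi> y))
    = (\<Sum>y\<in>set xs. (\<Sum>z\<in>set xs. M x z * green M xs z y) * \<phi> y)"
    unfolding sum_distrib_left sum_distrib_right by (subst sum.swap) (simp add: mult.assoc)
  also have "\<dots> = (\<Sum>y\<in>set xs. if x = y then \<phi> y else 0)"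
    using green_right_inverse[OF assms] by (intro sum.cong) auto
  finally show ?thesis using assms by simp
qed

text \<open>A right inverse of an injective square matrix is a left inverse: \<psi> and the image of
  M \<psi> under the Green's function solve the same system.\<close>

lemma green_left_inverse:
  assumes "distinct xs" "nondegenerate M (set xs)" "x \<in> set xs"
  shows "(\<Sum>y\<in>set xs. green M xs x y * (\<Sum>z\<in>set xs. M y z * \<psi> z)) = \<psi> x"
proof -
  define \<phi> where "\<phi> y = (\<Sum>z\<in>set xs. M y z * \<psi> z)" for y
  have "(\<Sum>y\<in>set xs. green M xs x y * \<phi> y) - \<psi> x = 0"
    by (rule nondegenerateD[OF assms(2) _ assms(3), of "\<lambda>x. (\<Sum>y\<in>set xs. green M xs x y * \<phi> y) - \<psi> x"])
       (simp add: right_diff_distrib sum_subtractf green_solves[OF assms(1,2)] \<phi>_def[symmetric])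
  then show ?thesis by (simp add: \<phi>_def)
qed

text \<open>Column \<open>y\<close> of the smaller Green's function, extended by 0, vanishes at
  \<open>x\<close> in \<open>W\<close>. Recover this 0 with the left inverse on \<open>xs\<close>:
  the rows in \<open>ys\<close> reproduce the unit vector at \<open>y\<close> and contribute
  \<open>green M xs x y\<close>, the rows in \<open>W\<close> contribute the sum.\<close>

lemma geometric_resolvent_identity:
  assumes xs: "distinct xs" "nondegenerate M (set xs)"
    and ys: "distinct ys" "set ys = set xs - W"
    and x: "x \<in> set xs \<inter> W" and y: "y \<in> set ys"
  shows "green M xs x y = - (\<Sum>b\<in>set xs \<inter> W. \<Sum>a\<in>set ys. green M xs x b * M b a * green M ys a y)"
proof -
  let ?g = "\<lambda>z. green M ys z y"
  have M: "(\<Sum>z\<in>set xs. M c z * ?g z) = (\<Sum>z\<in>set ys. M c z * ?g z)" for c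
    using ys by (intro sum.mono_neutral_right) (auto simp: green_outside)
  have nd: "nondegenerate M (set ys)"
    using xs(2) by (rule nondegenerate_subset) (use ys in auto)
  have split: "set xs = (set xs \<inter> W) \<union> set ys" "(set xs \<inter> W) \<inter> set ys = {}"
    using ys by auto
  have "0 = ?g x" using x ys by (simp add: green_outside)
  also have "\<dots> = (\<Sum>c\<in>set xs. green M xs x c * (\<Sum>z\<in>set ys. M c z * ?g z))"
    using green_left_inverse[OF xs, of x ?g] x M by simp
  also have "\<dots> = (\<Sum>c\<in>set xs \<inter> W. green M xs x c * (\<Sum>z\<in>set ys. M c z * ?g z))
      + (\<Sum>c\<in>set ys. green M xs x c * (\<Sum>z\<in>set ys. M c z * ?g z))"
    by (subst split(1), subst sum.union_disjoint) (use split in auto)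
  also have "(\<Sum>c\<in>set ys. green M xs x c * (\<Sum>z\<in>set ys. M c z * ?g z))
      = (\<Sum>c\<in>set ys. if c = y then green M xs x c else 0)"
    using green_right_inverse[OF ys(1) nd _ y] by (intro sum.cong) auto
  also have "\<dots> = green M xs x y" using y by simp
  finally have "green M xs x y = - (\<Sum>c\<in>set xs \<inter> W. green M xs x c * (\<Sum>z\<in>set ys. M c z * ?g z))"
    by (simp add: eq_neg_iff_add_eq_0 add.commute)
  then show ?thesis by (simp add: sum_distrib_left mult.assoc)
qed

section \<open>Schroedinger matrices\<close>

text \<open>The spectral parameter is absorbed into the complex potential \<open>v\<close>, so that
  this will be the matrix of H - z, not of H.\<close>

definition schrodinger :: "('v \<Rightarrow> 'v \<Rightarrow> bool) \<Rightarrow> ('v \<Rightarrow> complex) \<Rightarrow> 'v \<Rightarrow> 'v \<Rightarrow> complex" where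
  "schrodinger adj v x y = (if adj x y then 1 else 0) + (if x = y then v x else 0)"

text \<open>The adjacency matrix is real and symmetric, so its quadratic form is real and only the
  potential contributes.\<close>

lemma Im_schrodinger_form:
  assumes "symp adj" "finite S"
  shows "Im (\<Sum>x\<in>S. cnj (\<psi> x) * (\<Sum>z\<in>S. schrodinger adj v x z * \<psi> z)) = (\<Sum>x\<in>S. Im (v x) * (cmod (\<psi> x))\<^sup>2)"
proof -
  define a where "a x z = (if adj x z then 1 else 0 :: complex)" for x z
  define Q where "Q = (\<Sum>x\<in>S. \<Sum>z\<in>S. cnj (\<psi> x) * (a x z * \<psi> z))"
  have a: "cnj (a x z) = a z x" for x z
    using sympD[OF assms(1)] by (auto simp: a_def)
  have "cnj Q = (\<Sum>x\<in>S. \<Sum>z\<in>S. cnj (\<psi> z) * (a z x * \<psi> x))"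
    by (simp add: Q_def a mult_ac)
  also have "\<dots> = Q" unfolding Q_def by (rule sum.swap)
  finally have "Im Q = 0" by (metis Reals_cnj_iff complex_is_Real_iff)
  moreover have "(\<Sum>x\<in>S. cnj (\<psi> x) * (\<Sum>z\<in>S. schrodinger adj v x z * \<psi> z))
      = Q + (\<Sum>x\<in>S. v x * of_real ((cmod (\<psi> x))\<^sup>2))"
  proof -
    have "cnj (\<psi> x) * (\<Sum>z\<in>S. schrodinger adj v x z * \<psi> z)
        = (\<Sum>z\<in>S. cnj (\<psi> x) * (a x z * \<psi> z)) + v x * of_real ((cmod (\<psi> x))\<^sup>2)" if "x \<in> S" for x
    proof -
      have "(\<Sum>z\<in>S. schrodinger adj v x z * \<psi> z)
          = (\<Sum>z\<in>S. a x z * \<psi> z + (if x = z then v x * \<psi> x else 0))"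
        by (intro sum.cong) (auto simp: schrodinger_def a_def distrib_right)
      also have "\<dots> = (\<Sum>z\<in>S. a x z * \<psi> z) + v x * \<psi> x"
        using that assms(2) by (simp add: sum.distrib)
      moreover have "of_real ((cmod (\<psi> x))\<^sup>2) = cnj (\<psi> x) * \<psi> x"
        by (subst complex_norm_square) (rule mult.commute)
      ultimately show ?thesis
        by (simp add: distrib_left sum_distrib_left mult_ac del: of_real_power)
    qed
    then show ?thesis by (simp add: Q_def sum.distrib)
  qed
  ultimately show ?thesis by simp
qed

text \<open>The form vanishes at a null vector, but its imaginary part is a sum of terms of one
  sign, each of which must then vanish. Restriction to a subset preserves this structure.\<close>

lemma nondegenerate_schrodinger:
  assumes "symp adj" "finite S" "\<And>x. x \<in> S \<Longrightarrow> Im (v x) < 0"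
  shows "nondegenerate (schrodinger adj v) S"
  unfolding nondegenerate_def
proof (intro allI impI ballI)
  fix T \<psi> x
  assume T: "T \<subseteq> S" and 0: "\<forall>x\<in>T. (\<Sum>z\<in>T. schrodinger adj v x z * \<psi> z) = 0" and x: "x \<in> T"
  have fin: "finite T" using T assms finite_subset by blast
  have "(\<Sum>x\<in>T. - (Im (v x) * (cmod (\<psi> x))\<^sup>2)) = 0"
    using Im_schrodinger_form[OF assms(1) fin, of \<psi> v] 0 by (simp add: sum_negf)
  moreover have "0 \<le> - (Im (v x) * (cmod (\<psi> x))\<^sup>2)" if "x \<in> T" for x
  proof -
    have "Im (v x) < 0" using assms(3) T that by blast
    then show ?thesis by (simp add: mult_nonpos_nonneg)
  qed
  ultimately have "\<forall>x\<in>T. - (Im (v x) * (cmod (\<psi> x))\<^sup>2) = 0"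
    using fin by (subst (asm) sum_nonneg_eq_0_iff) auto
  moreover have "Im (v x) \<noteq> 0" using assms(3)[of x] T x by auto
  ultimately show "\<psi> x = 0" using x by auto
qed

section \<open>Quadratic forms of the Green's function in one complex coupling\<close>

definition perturb :: "'v set \<Rightarrow> ('v \<Rightarrow> complex) \<Rightarrow> real \<Rightarrow> complex \<Rightarrow> 'v \<Rightarrow> complex" where
  "perturb W v lam \<zeta> p = v p + (if p \<in> W then of_real lam * \<zeta> else 0)"

text \<open>The coefficient \<open>2\<close> keeps the test vector \<open>2 \<delta>\<^sub>x + \<theta> \<delta>\<^sub>b\<close> nonzero even when \<open>x = b\<close>, so that
  its quadratic form has strictly positive imaginary part.\<close>

definition test_form :: "('v \<Rightarrow> 'v \<Rightarrow> complex) \<Rightarrow> complex \<Rightarrow> 'v \<Rightarrow> 'v \<Rightarrow> complex" where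
  "test_form g \<theta> x b = 4 * g x x + 2 * \<theta> * g x b + 2 * cnj \<theta> * g b x + cnj \<theta> * \<theta> * g b b"

text \<open>Weighting with \<open>cnj \<theta>\<close> and summing over the fourth roots of unity
  cancels everything except the term \<open>2 * \<theta> * g x b\<close>, which is counted four
  times.\<close>

lemma test_form_polarization:
  "8 * g x b = test_form g 1 x b - \<i> * test_form g \<i> x b - test_form g (-1) x b + \<i> * test_form g (-\<i>) x b"
  by (simp add: test_form_def algebra_simps)

text \<open>Let \<phi> be the test vector and \<eta> its image under the Green's function. The
  conjugate of \<Phi> is the form of the matrix at \<eta>, so Im \<Phi> is the total absorption of
  \<eta>, which is positive. For the size, let m be the larger of |\<eta>| at \<open>x\<close> and
  \<open>b\<close>. Then |\<Phi>| is at most 3 m, while absorption at the point of \<open>W\<close>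
  that attains m gives that lam |Im \<zeta>| m^2 is at most |\<Phi>|. Combining the two leaves the
  constant 9 = 3^2.\<close>

lemma test_form_green_bounds:
  assumes "symp adj" "distinct xs" "x \<in> set xs" "b \<in> set xs" "x \<in> W" "b \<in> W"
    and "cmod \<theta> = 1" "0 < lam" "0 < \<epsilon>" "Im \<zeta> < \<epsilon> / lam"
    and v: "\<And>p. p \<in> set xs \<Longrightarrow> Im (v p) = - \<epsilon>"
  defines "\<Phi> \<equiv> test_form (green (schrodinger adj (perturb W v lam \<zeta>)) xs) \<theta> x b"
  shows "0 < Im \<Phi>" and "Im \<zeta> < 0 \<Longrightarrow> cmod \<Phi> \<le> 9 / lam / (- Im \<zeta>)"
proof -
  let ?v = "perturb W v lam \<zeta>"
  let ?G = "green (schrodinger adj ?v) xs"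
  define \<phi> where "\<phi> p = (if p = x then 2 else 0) + (if p = b then \<theta> else 0)" for p
  define \<eta> where "\<eta> p = 2 * ?G p x + \<theta> * ?G p b" for p
  have "lam * Im \<zeta> < \<epsilon>"
    using assms by (simp add: field_simps)
  then have neg: "Im (?v p) < 0" if "p \<in> set xs" for p
    using v[OF that] \<open>0 < \<epsilon>\<close> by (simp add: perturb_def)
  have sum_\<phi>: "(\<Sum>q\<in>set xs. f q * \<phi> q) = 2 * f x + \<theta> * f b" for f
  proof -
    have "(\<Sum>q\<in>set xs. f q * \<phi> q) = (\<Sum>q\<in>set xs. (if q = x then 2 * f x else 0) + (if q = b then \<theta> * f b else 0))"
      by (intro sum.cong) (auto simp: \<phi>_def algebra_simps)
    then show ?thesis using assms by (simp add: sum.distrib)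
  qed
  have M\<eta>: "(\<Sum>q\<in>set xs. schrodinger adj ?v p q * \<eta> q) = \<phi> p" if "p \<in> set xs" for p
    using green_solves[OF assms(2) nondegenerate_schrodinger[OF assms(1) _ neg] that, where \<phi> = \<phi>]
    by (simp add: sum_\<phi> \<eta>_def)
  have \<Phi>: "\<Phi> = 2 * \<eta> x + cnj \<theta> * \<eta> b"
    by (simp add: \<Phi>_def test_form_def \<eta>_def algebra_simps)
  have "(\<Sum>p\<in>set xs. cnj (\<eta> p) * (\<Sum>q\<in>set xs. schrodinger adj ?v p q * \<eta> q)) = cnj \<Phi>"
    by (simp add: M\<eta> sum_\<phi> \<Phi>)
  then have Im\<Phi>: "Im \<Phi> = (\<Sum>p\<in>set xs. - Im (?v p) * (cmod (\<eta> p))\<^sup>2)"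
    using Im_schrodinger_form[OF assms(1), of "set xs" \<eta> ?v] by (simp add: sum_negf)
  have nn: "0 \<le> - Im (?v p) * (cmod (\<eta> p))\<^sup>2" if "p \<in> set xs" for p
    using neg[OF that] by (intro mult_nonneg_nonneg) auto
  have "\<exists>p\<in>set xs. \<eta> p \<noteq> 0"
  proof (rule ccontr)
    assume "\<not> ?thesis"
    then have "\<phi> x = 0" using M\<eta>[of x] assms by simp
    then have "(if x = b then 2 + \<theta> else 2) = 0" by (auto simp: \<phi>_def split: if_splits)
    then have "\<theta> = -2" by (auto split: if_splits simp: add_eq_0_iff)
    then show False using \<open>cmod \<theta> = 1\<close> by simp
  qed
  then obtain p where p: "p \<in> set xs" "\<eta> p \<noteq> 0" by blast
  then have "0 < - Im (?v p) * (cmod (\<eta> p))\<^sup>2"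
    using neg[of p] by (intro mult_pos_pos) auto
  then show "0 < Im \<Phi>" unfolding Im\<Phi> using p nn by (intro sum_pos2[of _ p]) auto
  assume \<zeta>: "Im \<zeta> < 0"
  define m where "m = max (cmod (\<eta> x)) (cmod (\<eta> b))"
  have "cmod \<Phi> \<le> 2 * cmod (\<eta> x) + cmod (\<eta> b)"
    unfolding \<Phi> using norm_triangle_ineq[of "2 * \<eta> x" "cnj \<theta> * \<eta> b"] \<open>cmod \<theta> = 1\<close>
    by (simp add: norm_mult)
  then have \<Phi>m: "cmod \<Phi> \<le> 3 * m" by (simp add: m_def)
  \<comment> \<open>Here the contribution of \<epsilon> to the absorption is discarded, which makes
    the upper bound uniform in \<epsilon>.\<close>
  have one: "lam * (- Im \<zeta>) * (cmod (\<eta> p))\<^sup>2 \<le> Im \<Phi>" if "p \<in> set xs" "p \<in> W" for p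
  proof -
    have "lam * (- Im \<zeta>) \<le> - Im (?v p)"
      using v[OF that(1)] that(2) \<open>0 < \<epsilon>\<close> by (simp add: perturb_def)
    then have "lam * (- Im \<zeta>) * (cmod (\<eta> p))\<^sup>2 \<le> - Im (?v p) * (cmod (\<eta> p))\<^sup>2"
      by (intro mult_right_mono) auto
    also have "\<dots> \<le> Im \<Phi>"
      unfolding Im\<Phi> using nn that(1) by (intro member_le_sum) auto
    finally show ?thesis .
  qed
  have "lam * (- Im \<zeta>) * m\<^sup>2 \<le> Im \<Phi>"
    using one[of x] one[of b] assms by (auto simp: m_def max_def)
  also have "\<dots> \<le> cmod \<Phi>" using abs_Im_le_cmod[of \<Phi>] by linarith
  finally have *: "lam * (- Im \<zeta>) * m\<^sup>2 \<le> cmod \<Phi>" .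
  have "cmod \<Phi> * (lam * (- Im \<zeta>) * cmod \<Phi>) \<le> cmod \<Phi> * 9"
  proof -
    have "(cmod \<Phi>)\<^sup>2 \<le> (3 * m)\<^sup>2" using \<Phi>m by (intro power_mono) auto
    then have "lam * (- Im \<zeta>) * (cmod \<Phi>)\<^sup>2 \<le> lam * (- Im \<zeta>) * (9 * m\<^sup>2)"
      using \<open>0 < lam\<close> \<zeta> by (intro mult_left_mono) (auto simp: power_mult_distrib mult_nonneg_nonpos)
    also have "\<dots> \<le> 9 * cmod \<Phi>" using * by simp
    finally show ?thesis by (simp add: power2_eq_square mult_ac)
  qed
  moreover have "0 < cmod \<Phi>" using \<open>0 < Im \<Phi>\<close> by auto
  ultimately have "lam * (- Im \<zeta>) * cmod \<Phi> \<le> 9"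
    using mult_le_cancel_left_pos by blast
  then show "cmod \<Phi> \<le> 9 / lam / (- Im \<zeta>)"
    using \<zeta> \<open>0 < lam\<close> by (subst pos_le_divide_eq, simp) (subst pos_le_divide_eq, auto simp: mult_ac)
qed

lemma holomorphic_on_schrodinger:
  assumes "\<And>p. (\<lambda>\<zeta>. v \<zeta> p) holomorphic_on U"
  shows "(\<lambda>\<zeta>. schrodinger adj (v \<zeta>) x y) holomorphic_on U"
  unfolding schrodinger_def using assms by (cases "x = y") (auto intro!: holomorphic_intros)

lemma measurable_schrodinger:
  assumes "\<And>p. (\<lambda>w. v w p) \<in> borel_measurable N"
  shows "(\<lambda>w. schrodinger adj (v w) x y) \<in> borel_measurable N"
  unfolding schrodinger_def using assms by (cases "x = y") auto

text \<open>Four test forms, each with the Herglotz bound for \<open>c = 9 / lam\<close>, after the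
  factor \<open>lam powr s\<close> has been taken out.\<close>

definition block_const :: "real \<Rightarrow> real \<Rightarrow> real" where
  "block_const s T = 4 * (9 powr s * (2 * T + 2 / (1 - s)) / cos (pi / 2 * s))"

lemma block_const_pos:
  assumes "0 < s" "s < 1" "0 < T"
  shows "0 < block_const s T"
  using cos_half_pi_mult_pos[OF assms(1,2)] assms by (simp add: block_const_def add_pos_pos)

text \<open>Polarization and subadditivity of the s-th power reduce the entry to four Herglotz
  functions. The bound is the same for all admissible \<open>v\<close>, \<open>\<epsilon>\<close>
  and \<open>xs\<close>, so it can be applied with the other couplings frozen.\<close>

lemma green_fractional_moment_block:
  assumes "symp adj" "distinct xs" "x \<in> set xs" "b \<in> set xs" "x \<in> W" "b \<in> W"
    and "0 < lam" "0 < \<epsilon>" and v: "\<And>p. p \<in> set xs \<Longrightarrow> Im (v p) = - \<epsilon>"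
    and s: "0 < s" "s < 1" and T: "0 < T"
  shows "(\<integral>\<^sup>+ t. ennreal (cmod (green (schrodinger adj (perturb W v lam (of_real t))) xs x b) powr s)
      * indicator {-T..T} t \<partial>lborel) \<le> ennreal (block_const s T / lam powr s)"
proof -
  let ?G = "\<lambda>\<zeta>. green (schrodinger adj (perturb W v lam \<zeta>)) xs"
  let ?\<Theta> = "{1, \<i>, -1, -\<i>}"
  let ?\<kappa> = "(9 / lam) powr s * (2 * T + 2 / (1 - s)) / cos (pi / 2 * s)"
  have distinct_\<Theta>: "card ?\<Theta> = 4" by (simp add: complex_eq_iff)
  have norm_\<Theta>: "cmod \<theta> = 1" if "\<theta> \<in> ?\<Theta>" for \<theta> using that by auto
  have hol: "(\<lambda>\<zeta>. test_form (?G \<zeta>) \<theta> x b) holomorphic_on {\<zeta>. Im \<zeta> < \<epsilon> / lam}" for \<theta>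
  proof -
    have "(\<lambda>\<zeta>. ?G \<zeta> p q) holomorphic_on {\<zeta>. Im \<zeta> < \<epsilon> / lam}" for p q
    proof (rule holomorphic_on_green[OF assms(2) nondegenerate_schrodinger[OF assms(1)]])
      fix \<zeta> p assume \<zeta>: "\<zeta> \<in> {\<zeta>. Im \<zeta> < \<epsilon> / lam}" and p: "p \<in> set xs"
      then have "lam * Im \<zeta> < \<epsilon>" using \<open>0 < lam\<close> by (simp add: field_simps)
      then show "Im (perturb W v lam \<zeta> p) < 0" using v[OF p] \<open>0 < \<epsilon>\<close> by (simp add: perturb_def)
    next
      show "(\<lambda>\<zeta>. schrodinger adj (perturb W v lam \<zeta>) p q) holomorphic_on {\<zeta>. Im \<zeta> < \<epsilon> / lam}" for p q
      proof (rule holomorphic_on_schrodinger)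
        show "(\<lambda>\<zeta>. perturb W v lam \<zeta> p) holomorphic_on {\<zeta>. Im \<zeta> < \<epsilon> / lam}" for p
          unfolding perturb_def by (cases "p \<in> W") (auto intro!: holomorphic_intros)
      qed
    qed simp
    then show ?thesis unfolding test_form_def by (intro holomorphic_intros)
  qed
  \<comment> \<open>The half-plane of holomorphy is that of height \<open>\<epsilon> / lam\<close>,
    and \<open>c = 9 / lam\<close>; the height does not enter the resulting bound.\<close>
  have form: "(\<integral>\<^sup>+ t. ennreal (cmod (test_form (?G (of_real t)) \<theta> x b) powr s) * indicator {-T..T} t \<partial>lborel)
      \<le> ennreal ?\<kappa>" if "\<theta> \<in> ?\<Theta>" for \<theta>
    using \<open>0 < lam\<close> \<open>0 < \<epsilon>\<close>
    by (intro Herglotz_fractional_moment[OF hol]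
        test_form_green_bounds[OF assms(1-6) norm_\<Theta>[OF that] \<open>0 < lam\<close> \<open>0 < \<epsilon>\<close> _ v] s T)
       (auto intro: less_trans[of _ 0])
  have cont: "continuous_on UNIV (\<lambda>t. test_form (?G (complex_of_real t)) \<theta> x b)" for \<theta>
    by (rule continuous_on_compose2[OF holomorphic_on_imp_continuous_on[OF hol]])
       (use \<open>0 < lam\<close> \<open>0 < \<epsilon>\<close> in \<open>auto intro!: continuous_intros\<close>)
  have meas [measurable]: "(\<lambda>t. test_form (?G (complex_of_real t)) \<theta> x b) \<in> borel_measurable borel" for \<theta>
    by (intro borel_measurable_continuous_onI cont)
  have pt: "cmod (?G \<zeta> x b) powr s \<le> (\<Sum>\<theta>\<in>?\<Theta>. cmod (test_form (?G \<zeta>) \<theta> x b) powr s)" for \<zeta>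
  proof -
    have "cmod (8 * ?G \<zeta> x b) \<le> (\<Sum>\<theta>\<in>?\<Theta>. cmod (test_form (?G \<zeta>) \<theta> x b))"
    proof -
      have tri: "cmod (p - \<i> * q - r + \<i> * u) \<le> cmod p + cmod q + cmod r + cmod u" for p q r u
        using norm_triangle_ineq[of "p - \<i> * q - r" "\<i> * u"] norm_triangle_ineq4[of "p - \<i> * q" r]
          norm_triangle_ineq4[of p "\<i> * q"] by (simp add: norm_mult)
      have "(\<Sum>\<theta>\<in>?\<Theta>. cmod (test_form (?G \<zeta>) \<theta> x b)) = cmod (test_form (?G \<zeta>) 1 x b)
        + cmod (test_form (?G \<zeta>) \<i> x b) + cmod (test_form (?G \<zeta>) (-1) x b) + cmod (test_form (?G \<zeta>) (-\<i>) x b)"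
        by (simp add: complex_eq_iff)
      then show ?thesis using tri by (simp only: test_form_polarization[of "?G \<zeta>"])
    qed
    moreover have "cmod (?G \<zeta> x b) \<le> cmod (8 * ?G \<zeta> x b)" by (simp add: norm_mult)
    ultimately have "cmod (?G \<zeta> x b) \<le> (\<Sum>\<theta>\<in>?\<Theta>. cmod (test_form (?G \<zeta>) \<theta> x b))"
      by (rule order_trans[rotated])
    then have "cmod (?G \<zeta> x b) powr s \<le> (\<Sum>\<theta>\<in>?\<Theta>. cmod (test_form (?G \<zeta>) \<theta> x b)) powr s"
      using s by (intro powr_mono2) simp_all
    also have "\<dots> \<le> (\<Sum>\<theta>\<in>?\<Theta>. cmod (test_form (?G \<zeta>) \<theta> x b) powr s)"
      using s by (intro powr_sum_le) auto
    finally show ?thesis .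
  qed
  have "(\<integral>\<^sup>+ t. ennreal (cmod (?G (of_real t) x b) powr s) * indicator {-T..T} t \<partial>lborel)
    \<le> (\<integral>\<^sup>+ t. (\<Sum>\<theta>\<in>?\<Theta>. ennreal (cmod (test_form (?G (of_real t)) \<theta> x b) powr s) * indicator {-T..T} t) \<partial>lborel)"
  proof (rule nn_integral_mono)
    fix t :: real
    have "ennreal (cmod (?G (of_real t) x b) powr s)
        \<le> (\<Sum>\<theta>\<in>?\<Theta>. ennreal (cmod (test_form (?G (of_real t)) \<theta> x b) powr s))"
      by (subst sum_ennreal) (use pt in \<open>simp_all del: sum.insert add: ennreal_leI\<close>)
    then show "ennreal (cmod (?G (of_real t) x b) powr s) * indicator {-T..T} t
        \<le> (\<Sum>\<theta>\<in>?\<Theta>. ennreal (cmod (test_form (?G (of_real t)) \<theta> x b) powr s) * indicator {-T..T} t)"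
      unfolding sum_distrib_right[symmetric] by (rule mult_right_mono) simp
  qed
  also have "\<dots> = (\<Sum>\<theta>\<in>?\<Theta>. \<integral>\<^sup>+ t. ennreal (cmod (test_form (?G (of_real t)) \<theta> x b) powr s) * indicator {-T..T} t \<partial>lborel)"
    by (intro nn_integral_sum) measurable
  also have "\<dots> \<le> (\<Sum>\<theta>\<in>?\<Theta>. ennreal ?\<kappa>)" by (intro sum_mono form)
  also have "\<dots> = 4 * ennreal ?\<kappa>" by (simp only: sum_constant distinct_\<Theta>) simp
  also have "\<dots> = ennreal (4 * ?\<kappa>)"
    by (subst ennreal_mult') (use s T in auto)
  also have "4 * ?\<kappa> = block_const s T / lam powr s"
    using \<open>0 < lam\<close> by (simp add: block_const_def powr_divide)
  finally show ?thesis .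
qed

section \<open>Block potentials\<close>

text \<open>The finite index set \<open>I\<close> stands for the centres whose blocks can meet the
  box. Subtracting \<open>z\<close> gives the potential imaginary part \<open>- Im z\<close>
  everywhere.\<close>

definition block_potential ::
  "'v set \<Rightarrow> ('v \<Rightarrow> 'v set) \<Rightarrow> real \<Rightarrow> complex \<Rightarrow> ('v \<Rightarrow> real) \<Rightarrow> 'v \<Rightarrow> complex" where
  "block_potential I B lam z w p = of_real lam * (\<Sum>u\<in>{u\<in>I. p \<in> B u}. of_real (w u)) - z"

lemma Im_block_potential [simp]: "Im (block_potential I B lam z w p) = - Im z"
  by (simp add: block_potential_def)

lemma block_potential_upd:
  assumes "finite I" "u \<in> I"
  shows "block_potential I B lam z (w(u := t)) = perturb (B u) (block_potential (I - {u}) B lam z w) lam (of_real t)"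
proof
  fix p
  let ?I = "{v\<in>I - {u}. p \<in> B v}"
  have eq: "{v\<in>I. p \<in> B v} = (if p \<in> B u then insert u ?I else ?I)"
    using assms(2) by auto
  have "(\<Sum>v\<in>?I. complex_of_real ((w(u := t)) v)) = (\<Sum>v\<in>?I. of_real (w v))"
    by (intro sum.cong) auto
  then show "block_potential I B lam z (w(u := t)) p
      = perturb (B u) (block_potential (I - {u}) B lam z w) lam (of_real t) p"
    unfolding block_potential_def perturb_def eq using assms(1) by (simp add: algebra_simps)
qed

lemma green_potential_cong:
  assumes "\<And>p. p \<in> set xs \<Longrightarrow> v p = v' p"
  shows "green (schrodinger adj v) xs x y = green (schrodinger adj v') xs x y"
  by (rule green_cong) (use assms in \<open>simp add: schrodinger_def\<close>)

lemma measurable_green_block: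
  assumes "\<And>u. u \<in> I \<Longrightarrow> (\<lambda>w. f w u) \<in> borel_measurable N"
  shows "(\<lambda>w. green (schrodinger adj (block_potential I B lam z (f w))) xs x y) \<in> borel_measurable N"
proof (intro measurable_green measurable_schrodinger)
  fix p
  have [measurable]: "(\<lambda>w. complex_of_real (f w u)) \<in> borel_measurable N" if "u \<in> I" for u
    using measurable_compose[OF assms[OF that] borel_measurable_of_real] .
  show "(\<lambda>w. block_potential I B lam z (f w) p) \<in> borel_measurable N"
    unfolding block_potential_def by (intro borel_measurable_diff borel_measurable_times borel_measurable_sum) auto
qed

text \<open>By Fubini, \<omega>_u is integrated first: \<open>h\<close> is constant in it, and the
  average of the Green's function factor is bounded uniformly in the other couplings. All that is
  asked of the density is domination by \<open>D\<close> times Lebesgue measure on an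
  interval.\<close>

lemma green_block_decoupling:
  fixes \<mu> :: "real measure" and h :: "('v \<Rightarrow> real) \<Rightarrow> ennreal"
  assumes \<mu>: "prob_space \<mu>" "sets \<mu> = sets borel"
    and dens: "\<And>f :: real \<Rightarrow> ennreal. f \<in> borel_measurable borel \<Longrightarrow>
      (\<integral>\<^sup>+ t. f t \<partial>\<mu>) \<le> ennreal D * (\<integral>\<^sup>+ t. f t * indicator {-T..T} t \<partial>lborel)"
    and I: "finite I" "u \<in> I"
    and "symp adj" "distinct xs" "x \<in> set xs" "b \<in> set xs" "x \<in> B u" "b \<in> B u"
    and "0 < lam" "0 < Im z" "0 < s" "s < 1" "0 < T" "0 \<le> D"
    and h: "h \<in> borel_measurable (PiM I (\<lambda>_. \<mu>))" "\<And>w t. h (w(u := t)) = h w"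
  shows "(\<integral>\<^sup>+ w. ennreal (cmod (green (schrodinger adj (block_potential I B lam z w)) xs x b) powr s) * h w
      \<partial>PiM I (\<lambda>_. \<mu>)) \<le> ennreal (D * block_const s T / lam powr s) * (\<integral>\<^sup>+ w. h w \<partial>PiM I (\<lambda>_. \<mu>))"
proof -
  interpret \<mu>: prob_space \<mu> by fact
  interpret product_sigma_finite "\<lambda>_. \<mu>"
    by standard
  let ?g = "\<lambda>w. ennreal (cmod (green (schrodinger adj (block_potential I B lam z w)) xs x b) powr s)"
  let ?\<kappa> = "D * block_const s T / lam powr s"
  define I' where "I' = I - {u}"
  have I': "finite I'" "u \<notin> I'" "I = insert u I'" using I by (auto simp: I'_def)
  have comp: "(\<lambda>w. w v) \<in> borel_measurable (PiM I (\<lambda>_. \<mu>))" if "v \<in> I" for v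
    using measurable_component_singleton[OF that, of "\<lambda>_. \<mu>"] by (simp cong: measurable_cong_sets add: \<mu>)
  have g: "?g \<in> borel_measurable (PiM I (\<lambda>_. \<mu>))"
    using measurable_green_block[of I "\<lambda>w. w", OF comp] by measurable
  have gt: "(\<lambda>t. ?g (w(u := t))) \<in> borel_measurable borel" for w
  proof -
    have "(\<lambda>t. green (schrodinger adj (block_potential I B lam z (w(u := t)))) xs x b) \<in> borel_measurable borel"
      by (rule measurable_green_block) (simp add: fun_upd_def)
    then show ?thesis by measurable
  qed
  have inner: "(\<integral>\<^sup>+ t. ?g (w(u := t)) * h (w(u := t)) \<partial>\<mu>) \<le> (\<integral>\<^sup>+ t. ennreal ?\<kappa> * h (w(u := t)) \<partial>\<mu>)" for w
  proof -
    have "(\<integral>\<^sup>+ t. ?g (w(u := t)) \<partial>\<mu>) \<le> ennreal D * (\<integral>\<^sup>+ t. ?g (w(u := t)) * indicator {-T..T} t \<partial>lborel)"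
      by (rule dens[OF gt])
    also have "\<dots> \<le> ennreal D * ennreal (block_const s T / lam powr s)"
      unfolding block_potential_upd[OF I]
      by (intro mult_left_mono green_fractional_moment_block[where \<epsilon> = "Im z"]) (use assms in auto)
    also have "\<dots> = ennreal ?\<kappa>" using \<open>0 \<le> D\<close> by (simp add: ennreal_mult'[symmetric])
    finally have *: "(\<integral>\<^sup>+ t. ?g (w(u := t)) \<partial>\<mu>) \<le> ennreal ?\<kappa>" .
    have "(\<lambda>t. ?g (w(u := t))) \<in> borel_measurable \<mu>"
      using gt[of w] by (simp cong: measurable_cong_sets add: \<mu>)
    then have "(\<integral>\<^sup>+ t. ?g (w(u := t)) * h (w(u := t)) \<partial>\<mu>) = (\<integral>\<^sup>+ t. ?g (w(u := t)) \<partial>\<mu>) * h w"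
      unfolding h(2) by (rule nn_integral_multc)
    also have "\<dots> \<le> ennreal ?\<kappa> * h w" by (intro mult_right_mono *) simp
    \<comment> \<open>The constant is rewritten as an average over \<mu>, of total mass 1, so that
      the full product integral of \<open>h\<close> can be reassembled.\<close>
    also have "\<dots> = (\<integral>\<^sup>+ t. ennreal ?\<kappa> * h (w(u := t)) \<partial>\<mu>)"
      unfolding h(2) by (simp add: \<mu>.emeasure_space_1)
    finally show ?thesis .
  qed
  have "(\<integral>\<^sup>+ w. ?g w * h w \<partial>PiM I (\<lambda>_. \<mu>)) = (\<integral>\<^sup>+ w. (\<integral>\<^sup>+ t. ?g (w(u := t)) * h (w(u := t)) \<partial>\<mu>) \<partial>PiM I' (\<lambda>_. \<mu>))"
    unfolding I'(3) by (rule product_nn_integral_insert[OF I'(1,2)])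
      (use g h(1) I'(3) in \<open>auto intro!: borel_measurable_times_ennreal\<close>)
  also have "\<dots> \<le> (\<integral>\<^sup>+ w. (\<integral>\<^sup>+ t. ennreal ?\<kappa> * h (w(u := t)) \<partial>\<mu>) \<partial>PiM I' (\<lambda>_. \<mu>))"
    by (intro nn_integral_mono inner)
  also have "\<dots> = (\<integral>\<^sup>+ w. ennreal ?\<kappa> * h w \<partial>PiM I (\<lambda>_. \<mu>))"
    unfolding I'(3) by (rule product_nn_integral_insert[OF I'(1,2), symmetric])
      (use h(1) I'(3) in auto)
  also have "\<dots> = ennreal ?\<kappa> * (\<integral>\<^sup>+ w. h w \<partial>PiM I (\<lambda>_. \<mu>))"
    using h(1) by (rule nn_integral_cmult)
  finally show ?thesis .
qed

text \<open>Each application of the geometric resolvent identity removes the block of \<open>x\<close>, gaining a factor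
  \<open>exp (- \<gamma> (R + 1))\<close> and bringing the left argument closer to \<open>y\<close> by at most \<open>R + 1\<close>; the remaining
  Green's function no longer depends on the random variable of the removed block.\<close>

lemma green_block_fractional_moment_decay:
  fixes \<mu> :: "real measure" and dst :: "'v \<Rightarrow> 'v \<Rightarrow> nat" and N R :: nat and B :: "'v \<Rightarrow> 'v set"
  assumes \<mu>: "prob_space \<mu>" "sets \<mu> = sets borel"
    and dens: "\<And>f :: real \<Rightarrow> ennreal. f \<in> borel_measurable borel \<Longrightarrow>
      (\<integral>\<^sup>+ t. f t \<partial>\<mu>) \<le> ennreal D * (\<integral>\<^sup>+ t. f t * indicator {-T..T} t \<partial>lborel)"
    and I: "finite I"
    and adj: "symp adj" "\<And>x y. adj x y \<Longrightarrow> dst x y \<le> 1"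
    and tri: "\<And>x y z. dst x z \<le> dst x y + dst y z"
    and diam: "\<And>u x y. u \<in> I \<Longrightarrow> x \<in> B u \<Longrightarrow> y \<in> B u \<Longrightarrow> dst x y \<le> R"
    and bdry: "\<And>u. u \<in> I \<Longrightarrow> finite {(b, a). b \<in> B u \<and> adj b a}"
      "\<And>u. u \<in> I \<Longrightarrow> card {(b, a). b \<in> B u \<and> adj b a} \<le> N"
    and par: "0 < lam" "0 < Im z" "0 < s" "s < 1" "0 < T" "0 \<le> D" "0 \<le> \<gamma>" "1 \<le> N"
    and large: "real N * (D * block_const s T / lam powr s) \<le> exp (- \<gamma> * (real R + 1))"
    and xs: "distinct xs" "\<And>p. p \<in> set xs \<Longrightarrow> \<exists>u\<in>I. p \<in> B u" "x \<in> set xs" "y \<in> set xs"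
  shows "(\<integral>\<^sup>+ w. ennreal (cmod (green (schrodinger adj (block_potential I B lam z w)) xs x y) powr s)
      \<partial>PiM I (\<lambda>_. \<mu>)) \<le> ennreal (exp (- \<gamma> * real (dst x y)))"
  using xs
\<comment> \<open>\<open>y\<close> stays fixed while \<open>x\<close> moves. Removing the block of
  \<open>x\<close> deletes at least \<open>x\<close>, so the list gets strictly shorter.\<close>
proof (induction "length xs" arbitrary: xs x rule: less_induct)
  case less
  interpret \<mu>: prob_space \<mu> by fact
  interpret P: prob_space "PiM I (\<lambda>_. \<mu>)" by (rule prob_space_PiM) (rule \<mu>)
  let ?\<kappa> = "D * block_const s T / lam powr s"
  let ?G = "\<lambda>w. green (schrodinger adj (block_potential I B lam z w))"
  have \<kappa>: "0 \<le> ?\<kappa>" using block_const_pos[OF par(3-5)] par by simp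
  obtain u where u: "u \<in> I" "x \<in> B u" using less.prems by blast
  have comp: "(\<lambda>w. w v) \<in> borel_measurable (PiM I (\<lambda>_. \<mu>))" if "v \<in> I" for v
    using measurable_component_singleton[OF that, of "\<lambda>_. \<mu>"] by (simp cong: measurable_cong_sets add: \<mu>)
  have G [measurable]: "(\<lambda>w. ?G w zs p q) \<in> borel_measurable (PiM I (\<lambda>_. \<mu>))" for zs p q
    using measurable_green_block[of I "\<lambda>w. w", OF comp] .
  note decouple = green_block_decoupling[where B = B and T = T and D = D, OF \<mu> dens I u(1) adj(1) less.prems(1,3) _ u(2) _ par(1-6)]
  show ?case
  proof (cases "y \<in> B u")
    case True
    have "(\<integral>\<^sup>+ w. ennreal (cmod (?G w xs x y) powr s) \<partial>PiM I (\<lambda>_. \<mu>)) \<le> ennreal ?\<kappa>"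
      using decouple[of y "\<lambda>_. 1"] True less.prems by (simp add: P.emeasure_space_1)
    \<comment> \<open>No boundary edge is summed over when both points share a block;
      \<open>1 \<le> N\<close> makes \<open>large\<close> cover this case too.\<close>
    also have "?\<kappa> \<le> real N * ?\<kappa>"
      using mult_right_mono[of 1 "real N" ?\<kappa>] \<open>1 \<le> N\<close> \<kappa> by simp
    also have "\<dots> \<le> exp (- \<gamma> * (real R + 1))" by (rule large)
    also have "\<dots> \<le> exp (- \<gamma> * real (dst x y))"
      using mult_left_mono[of "real (dst x y)" "real R + 1" \<gamma>] diam[OF u(1,2) True] par by simp
    finally show ?thesis by (simp add: ennreal_leI)
  next
    case False
    define ys where "ys = filter (\<lambda>p. p \<notin> B u) xs"
    have ys: "distinct ys" "set ys = set xs - B u" "y \<in> set ys" "length ys < length xs"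
      using less.prems False u length_filter_less[of x xs] by (auto simp: ys_def)
    define E where "E = {(b, a). b \<in> set xs \<inter> B u \<and> a \<in> set ys \<and> adj b a}"
    have E: "finite E" "card E \<le> N"
    proof -
      have "E \<subseteq> {(b, a). b \<in> B u \<and> adj b a}" by (auto simp: E_def)
      then show "finite E" "card E \<le> N"
        using bdry[OF u(1)] by (auto intro: finite_subset order_trans[OF card_mono])
    qed
    have resolvent: "?G w xs x y = - (\<Sum>(b, a)\<in>E. ?G w xs x b * ?G w ys a y)" for w
    proof -
      let ?M = "schrodinger adj (block_potential I B lam z w)"
      have M: "?M b a = (if adj b a then 1 else 0)" if "b \<in> set xs \<inter> B u" "a \<in> set ys" for b a
        using that ys(2) by (auto simp: schrodinger_def)
      have "?G w xs x y = - (\<Sum>b\<in>set xs \<inter> B u. \<Sum>a\<in>set ys. ?G w xs x b * ?M b a * ?G w ys a y)"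
        using adj less.prems ys u par
        by (intro geometric_resolvent_identity nondegenerate_schrodinger) auto
      also have "(\<Sum>b\<in>set xs \<inter> B u. \<Sum>a\<in>set ys. ?G w xs x b * ?M b a * ?G w ys a y)
          = (\<Sum>(b, a)\<in>(set xs \<inter> B u) \<times> set ys. if adj b a then ?G w xs x b * ?G w ys a y else 0)"
        unfolding sum.cartesian_product by (intro sum.cong) (auto simp: M)
      also have "\<dots> = (\<Sum>(b, a)\<in>E. ?G w xs x b * ?G w ys a y)"
        unfolding E_def by (intro sum.mono_neutral_cong_right) (auto split: if_splits)
      finally show ?thesis .
    qed
    have pt: "ennreal (cmod (?G w xs x y) powr s)
        \<le> (\<Sum>(b, a)\<in>E. ennreal (cmod (?G w xs x b) powr s) * ennreal (cmod (?G w ys a y) powr s))" for w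
    proof -
      have "cmod (?G w xs x y) \<le> (\<Sum>e\<in>E. cmod (?G w xs x (fst e) * ?G w ys (snd e) y))"
        unfolding resolvent norm_minus_cancel by (simp add: case_prod_beta sum_norm_le)
      then have "cmod (?G w xs x y) powr s \<le> (\<Sum>e\<in>E. cmod (?G w xs x (fst e) * ?G w ys (snd e) y)) powr s"
        using par by (intro powr_mono2) auto
      also have "\<dots> \<le> (\<Sum>e\<in>E. cmod (?G w xs x (fst e) * ?G w ys (snd e) y) powr s)"
        using par by (intro powr_sum_le) auto
      finally have "ennreal (cmod (?G w xs x y) powr s)
          \<le> ennreal (\<Sum>e\<in>E. cmod (?G w xs x (fst e) * ?G w ys (snd e) y) powr s)"
        by (rule ennreal_leI)
      also have "\<dots> = (\<Sum>e\<in>E. ennreal (cmod (?G w xs x (fst e) * ?G w ys (snd e) y) powr s))"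
        by (rule sum_ennreal[symmetric]) simp
      finally show ?thesis by (simp add: norm_mult powr_mult ennreal_mult case_prod_beta)
    qed
    \<comment> \<open>The subtraction in the exponent is taken in the reals, so the estimate remains
      meaningful when \<open>dst x y\<close> is below \<open>R + 1\<close>.\<close>
    have summand: "(\<integral>\<^sup>+ w. ennreal (cmod (?G w xs x b) powr s) * ennreal (cmod (?G w ys a y) powr s) \<partial>PiM I (\<lambda>_. \<mu>))
        \<le> ennreal (?\<kappa> * exp (- \<gamma> * (real (dst x y) - (real R + 1))))" if ba: "(b, a) \<in> E" for b a
    proof -
      have b: "b \<in> set xs" "b \<in> B u" and a: "a \<in> set ys" "adj b a" using ba by (auto simp: E_def)
      \<comment> \<open>\<omega>_u acts on \<open>B u\<close> only, and \<open>ys\<close> avoids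
        that set.\<close>
      have indep: "?G (w(u := t)) ys a y = ?G w ys a y" for w t
      proof (rule green_potential_cong)
        fix p assume "p \<in> set ys"
        then have "p \<notin> B u" using ys by auto
        then show "block_potential I B lam z (w(u := t)) p = block_potential I B lam z w p"
          unfolding block_potential_def by (intro arg_cong2[of _ _ _ _ "(-)"] arg_cong2[of _ _ _ _ "(*)"] sum.cong) auto
      qed
      have "dst x y \<le> dst x b + (dst b a + dst a y)"
        using tri[of x y b] tri[of b y a] by linarith
      also have "\<dots> \<le> R + (1 + dst a y)"
        using diam[OF u b(2)] adj(2)[OF a(2)] by linarith
      finally have "\<gamma> * (real (dst x y) - (real R + 1)) \<le> \<gamma> * real (dst a y)"
        using par by (intro mult_left_mono) auto
      then have e: "exp (- \<gamma> * real (dst a y)) \<le> exp (- \<gamma> * (real (dst x y) - (real R + 1)))" by simp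
      have "(\<integral>\<^sup>+ w. ennreal (cmod (?G w xs x b) powr s) * ennreal (cmod (?G w ys a y) powr s) \<partial>PiM I (\<lambda>_. \<mu>))
        \<le> ennreal ?\<kappa> * (\<integral>\<^sup>+ w. ennreal (cmod (?G w ys a y) powr s) \<partial>PiM I (\<lambda>_. \<mu>))"
        by (rule decouple) (use b indep in auto)
      also have "\<dots> \<le> ennreal ?\<kappa> * ennreal (exp (- \<gamma> * real (dst a y)))"
        by (intro mult_left_mono less.hyps) (use ys a less.prems in auto)
      also have "\<dots> = ennreal (?\<kappa> * exp (- \<gamma> * real (dst a y)))"
        by (rule ennreal_mult[symmetric, OF \<kappa>]) simp
      also have "\<dots> \<le> ennreal (?\<kappa> * exp (- \<gamma> * (real (dst x y) - (real R + 1))))"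
        by (intro ennreal_leI mult_left_mono e \<kappa>)
      finally show ?thesis .
    qed
    have "(\<integral>\<^sup>+ w. ennreal (cmod (?G w xs x y) powr s) \<partial>PiM I (\<lambda>_. \<mu>))
      \<le> (\<integral>\<^sup>+ w. (\<Sum>(b, a)\<in>E. ennreal (cmod (?G w xs x b) powr s) * ennreal (cmod (?G w ys a y) powr s)) \<partial>PiM I (\<lambda>_. \<mu>))"
      by (intro nn_integral_mono pt)
    also have "\<dots> = (\<Sum>(b, a)\<in>E. \<integral>\<^sup>+ w. ennreal (cmod (?G w xs x b) powr s) * ennreal (cmod (?G w ys a y) powr s) \<partial>PiM I (\<lambda>_. \<mu>))"
      unfolding case_prod_beta by (intro nn_integral_sum) measurable
    also have "\<dots> \<le> (\<Sum>(b, a)\<in>E. ennreal (?\<kappa> * exp (- \<gamma> * (real (dst x y) - (real R + 1)))))"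
      by (intro sum_mono) (use summand in auto)
    also have "\<dots> = ennreal (real (card E) * (?\<kappa> * exp (- \<gamma> * (real (dst x y) - (real R + 1)))))"
      by (subst ennreal_mult'[OF of_nat_0_le_iff]) (simp add: ennreal_of_nat_eq_real_of_nat case_prod_beta)
    also have "\<dots> \<le> ennreal (exp (- \<gamma> * real (dst x y)))"
    proof (rule ennreal_leI)
      let ?e = "exp (- \<gamma> * (real (dst x y) - (real R + 1)))"
      have "real (card E) * (?\<kappa> * ?e) \<le> real N * (?\<kappa> * ?e)"
        using E \<kappa> by (intro mult_right_mono mult_nonneg_nonneg) auto
      also have "\<dots> = (real N * ?\<kappa>) * ?e" by simp
      \<comment> \<open>\<open>large\<close> pays for the at most \<open>N\<close> edges and for the
        distance \<open>R + 1\<close> given up in this step, so no constant accumulates along the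
        iteration.\<close>
      also have "\<dots> \<le> exp (- \<gamma> * (real R + 1)) * ?e"
        by (intro mult_right_mono large) simp
      also have "\<dots> = exp (- \<gamma> * real (dst x y))"
        by (simp flip: exp_add add: algebra_simps)
      finally show "real (card E) * (?\<kappa> * ?e) \<le> exp (- \<gamma> * real (dst x y))" .
    qed
    finally show ?thesis .
  qed
qed

section \<open>The graph and the random operator\<close>

text \<open>Connectedness makes the \<open>LEAST\<close> in \<open>gdist\<close> attained;
  regularity gives balls that are finite with a bound independent of the centre.\<close>

locale connected_graph =
  fixes E :: "'v \<Rightarrow> 'v \<Rightarrow> bool" and k :: nat
  assumes sym: "symp E" and irrefl: "irreflp E" and conn: "E\<^sup>*\<^sup>* x y"
    and regular: "is_regular E k"
begin

lemma relpowp_gdist: "(E ^^ gdist E x y) x y"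
  unfolding gdist_def by (rule LeastI_ex) (use conn[of x y] in \<open>simp add: rtranclp_power\<close>)

lemma gdist_le: "(E ^^ n) x y \<Longrightarrow> gdist E x y \<le> n"
  unfolding gdist_def by (rule Least_le)

lemma relpowp_sym: "(E ^^ n) x y \<Longrightarrow> (E ^^ n) y x"
proof (induction n arbitrary: y)
  case (Suc n)
  then obtain z where "(E ^^ n) x z" "E z y" by auto
  then show ?case using Suc.IH sympD[OF sym] by (meson relpowp_Suc_I2)
qed simp

lemma gdist_sym: "gdist E x y = gdist E y x"
  by (meson antisym gdist_le relpowp_gdist relpowp_sym)

lemma gdist_triangle: "gdist E x z \<le> gdist E x y + gdist E y z"
  by (rule gdist_le) (auto simp: relpowp_add intro: relcomppI relpowp_gdist)

lemma gdist_self [simp]: "gdist E x x = 0"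
  using gdist_le[of 0 x x] by simp

lemma gdist_eq_0_iff [simp]: "gdist E x y = 0 \<longleftrightarrow> x = y"
  using relpowp_gdist[of x y] by auto

lemma gdist_adj: "E x y \<Longrightarrow> gdist E x y \<le> 1"
  by (rule gdist_le) (simp add: eq_OO)

lemma gdist_eq_1_iff: "gdist E x y = 1 \<longleftrightarrow> E x y"
proof
  assume "E x y"
  moreover have "x \<noteq> y" using \<open>E x y\<close> irreflpD[OF irrefl] by auto
  ultimately show "gdist E x y = 1" using gdist_adj[of x y] gdist_eq_0_iff[of x y] by linarith
qed (use relpowp_gdist[of x y] in auto)

lemma neighbours: "finite {y. E x y}" "card {y. E x y} = k"
  using regular by (auto simp: is_regular_def)

lemma ball: "finite {y. gdist E x y \<le> n} \<and> card {y. gdist E x y \<le> n} \<le> (k + 1) ^ n"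
proof (induction n)
  case (Suc n)
  let ?B = "{y. gdist E x y \<le> n}"
  let ?U = "\<Union>y\<in>?B. insert y {z. E y z}"
  have "{y. gdist E x y \<le> Suc n} \<subseteq> ?U"
  proof
    fix y assume y: "y \<in> {y. gdist E x y \<le> Suc n}"
    show "y \<in> ?U"
    proof (cases "gdist E x y \<le> n")
      case False
      then have "(E ^^ Suc n) x y" using y relpowp_gdist[of x y] by (simp add: le_Suc_eq)
      then obtain z where "(E ^^ n) x z" "E z y" by auto
      then show ?thesis using gdist_le by blast
    qed auto
  qed
  moreover have "finite ?U" using Suc neighbours by auto
  moreover have "card ?U \<le> (k + 1) ^ Suc n"
  proof -
    have "card ?U \<le> (\<Sum>y\<in>?B. card (insert y {z. E y z}))" using Suc by (intro card_UN_le) auto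
    also have "\<dots> \<le> (\<Sum>y\<in>?B. k + 1)"
      using neighbours by (intro sum_mono) (auto simp: card_insert_if)
    also have "\<dots> = card ?B * (k + 1)" by simp
    also have "\<dots> \<le> (k + 1) ^ n * (k + 1)" using Suc by (intro mult_right_mono) auto
    finally show ?thesis by (simp add: mult.commute)
  qed
  ultimately show ?case by (meson card_mono finite_subset order_trans)
qed simp

section \<open>Blocks of the graph and the matrix of the box operator\<close>

definition block :: "'v \<Rightarrow> nat \<Rightarrow> 'v \<Rightarrow> 'v set" where
  "block r m0 u = {x. gdist E u x \<le> m0 \<and> prec E r u x}"

text \<open>Cut a shortest path from \<open>r\<close> to \<open>p\<close> at the last level that is
  a multiple of \<open>m0 + 1\<close>; the cut point is the centre of a block containing
  \<open>p\<close>.\<close>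

lemma ex_block: "\<exists>u\<in>J_set E r m0. p \<in> block r m0 u"
proof -
  let ?n = "gdist E r p"
  define j where "j = (m0 + 1) * (?n div (m0 + 1))"
  have n: "?n = j + ?n mod (m0 + 1)" by (simp only: j_def mult_div_mod_eq)
  have "(E ^^ (j + ?n mod (m0 + 1))) r p" using relpowp_gdist[of r p] n by simp
  then obtain u where u: "(E ^^ j) r u" "(E ^^ (?n mod (m0 + 1))) u p"
    unfolding relpowp_add by auto
  \<comment> \<open>Both pieces have at most these lengths, and the triangle inequality forces
    equality because the lengths add up to the distance of \<open>r\<close> and
    \<open>p\<close>.\<close>
  then have "gdist E r u = j" "gdist E u p = ?n mod (m0 + 1)"
    using gdist_le[OF u(1)] gdist_le[OF u(2)] gdist_triangle[of r p u] n by linarith+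
  moreover have "?n mod (m0 + 1) \<le> m0" by (metis Suc_eq_plus1 less_Suc_eq_le mod_less_divisor zero_less_Suc)
  moreover have "(m0 + 1) dvd j" unfolding j_def by (rule dvd_triv_left)
  ultimately show ?thesis using n by (intro bexI[of _ u]) (auto simp: J_set_def block_def prec_def)
qed

lemma block_dist: "x \<in> block r m0 u \<Longrightarrow> y \<in> block r m0 u \<Longrightarrow> gdist E x y \<le> 2 * m0"
  using gdist_triangle[of x y u] gdist_sym[of x u] by (simp add: block_def)

text \<open>A crude count of all oriented edges that start in the block, inner ones included; what
  matters is independence of \<open>u\<close>.\<close>

lemma block_boundary:
  "finite {(b, a). b \<in> block r m0 u \<and> E b a}"
  "card {(b, a). b \<in> block r m0 u \<and> E b a} \<le> (k + 1) ^ m0 * k"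
proof -
  have eq: "{(b, a). b \<in> block r m0 u \<and> E b a} = Sigma (block r m0 u) (\<lambda>b. {a. E b a})" by auto
  have sub: "block r m0 u \<subseteq> {y. gdist E u y \<le> m0}" by (auto simp: block_def)
  then have fin: "finite (block r m0 u)" using ball finite_subset by blast
  have "card (block r m0 u) \<le> (k + 1) ^ m0" using card_mono[OF _ sub] ball[of u m0] by linarith
  then show "finite {(b, a). b \<in> block r m0 u \<and> E b a}"
    "card {(b, a). b \<in> block r m0 u \<and> E b a} \<le> (k + 1) ^ m0 * k"
    unfolding eq using fin neighbours by (simp_all add: card_SigmaI)
qed

lemma hamiltonian_box_matrix:
  assumes \<psi>: "\<psi> \<in> ell2 (Lambda_box E r L)" and x: "x \<in> Lambda_box E r L"
  shows "hamiltonian_box E r m0 w lam L \<psi> x - z * \<psi> x = (\<Sum>q\<in>Lambda_box E r L.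
    schrodinger E (block_potential (J_set E r m0 \<inter> Lambda_box E r L) (block r m0) lam z w) x q * \<psi> q)"
proof -
  let ?\<Lambda> = "Lambda_box E r L" and ?J = "J_set E r m0"
  let ?V = "\<Sum>u\<in>{u\<in>?J \<inter> ?\<Lambda>. x \<in> block r m0 u}. complex_of_real (w u)"
  have fin: "finite ?\<Lambda>" using ball by (simp add: Lambda_box_def)
  have chi: "chi ?\<Lambda> \<psi> = \<psi>" using \<psi> by (auto simp: chi_def ell2_def)
  have "laplacian E \<psi> x = (\<Sum>q | E x q. \<psi> q)" by (simp only: laplacian_def gdist_eq_1_iff)
  also have "\<dots> = (\<Sum>q\<in>{q. E x q} \<inter> ?\<Lambda>. \<psi> q)"
    using \<psi> neighbours by (intro sum.mono_neutral_right) (auto simp: ell2_def)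
  also have "\<dots> = (\<Sum>q\<in>?\<Lambda>. (if E x q then 1 else 0) * \<psi> q)"
    using fin by (intro sum.mono_neutral_cong_left) auto
  finally have lap: "laplacian E \<psi> x = (\<Sum>q\<in>?\<Lambda>. (if E x q then 1 else 0) * \<psi> q)" .
  \<comment> \<open>By \<open>prec\<close>, the centre of a block containing \<open>x\<close> is no
    farther from \<open>r\<close> than \<open>x\<close> is. It therefore lies in the box, and the
    infinite sum becomes finite.\<close>
  have "(\<Sum>\<^sub>\<infinity>u\<in>?J. complex_of_real (w u) * block_proj E r m0 u \<psi> x)
    = (\<Sum>\<^sub>\<infinity>u\<in>{u\<in>?J \<inter> ?\<Lambda>. x \<in> block r m0 u}. complex_of_real (w u) * \<psi> x)"
    using x by (intro infsum_cong_neutral)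
      (auto simp: block_proj_def chi_def block_def Lambda_box_def prec_def)
  also have "\<dots> = ?V * \<psi> x" using fin by (simp add: sum_distrib_right)
  finally have pot: "(\<Sum>\<^sub>\<infinity>u\<in>?J. complex_of_real (w u) * block_proj E r m0 u \<psi> x) = ?V * \<psi> x" .
  let ?v = "block_potential (?J \<inter> ?\<Lambda>) (block r m0) lam z w"
  have "(\<Sum>q\<in>?\<Lambda>. schrodinger E ?v x q * \<psi> q)
    = (\<Sum>q\<in>?\<Lambda>. (if E x q then 1 else 0) * \<psi> q + (if x = q then ?v x * \<psi> x else 0))"
    by (intro sum.cong) (auto simp: schrodinger_def distrib_right)
  also have "\<dots> = laplacian E \<psi> x + ?v x * \<psi> x"
    using fin x by (simp add: sum.distrib lap)
  finally show ?thesis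
    using x unfolding hamiltonian_box_def chi
    by (simp add: chi_def[of ?\<Lambda>] hamiltonian_def pot block_potential_def algebra_simps)
qed

text \<open>\<open>inv_into\<close> yields the true inverse once injectivity on \<open>ell2\<close>
  and a preimage are known. Nondegeneracy for nonreal \<open>z\<close> gives the first; column
  \<open>y\<close> of the Green's function, which is 0 off the box, is the second.\<close>

lemma resolvent_eq_green:
  assumes xs: "distinct xs" "set xs = Lambda_box E r L" and xy: "x \<in> set xs" "y \<in> set xs" and z: "0 < Im z"
  shows "ell2_inner (delta x) (resolvent_on (Lambda_box E r L) (hamiltonian_box E r m0 w lam L) z (delta y))
    = green (schrodinger E (block_potential (J_set E r m0 \<inter> Lambda_box E r L) (block r m0) lam z w)) xs x y"
proof -
  let ?\<Lambda> = "Lambda_box E r L"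
  let ?M = "schrodinger E (block_potential (J_set E r m0 \<inter> ?\<Lambda>) (block r m0) lam z w)"
  let ?A = "\<lambda>\<psi> x. hamiltonian_box E r m0 w lam L \<psi> x - z * \<psi> x"
  define g where "g p = green ?M xs p y" for p
  have nd: "nondegenerate ?M (set xs)"
    by (rule nondegenerate_schrodinger[OF sym]) (use z in auto)
  have g: "g \<in> ell2 ?\<Lambda>"
  proof -
    have g0: "g p = 0" if "p \<notin> ?\<Lambda>" for p using that xs by (simp add: g_def green_outside)
    have "(\<lambda>x. (cmod (g x))\<^sup>2) summable_on UNIV \<longleftrightarrow> (\<lambda>x. (cmod (g x))\<^sup>2) summable_on set xs"
      by (rule summable_on_cong_neutral) (use g0 xs in auto)
    then show ?thesis using g0 by (simp add: ell2_def)
  qed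
  have outside: "?A \<psi> p = 0" if "\<psi> \<in> ell2 ?\<Lambda>" "p \<notin> ?\<Lambda>" for \<psi> p
    using that by (simp add: hamiltonian_box_def chi_def ell2_def)
  have Ag: "?A g = delta y"
  proof
    fix p show "?A g p = delta y p"
    proof (cases "p \<in> ?\<Lambda>")
      case True
      then show ?thesis
        using hamiltonian_box_matrix[OF g True] green_right_inverse[OF xs(1) nd, of p y] xs xy
        by (simp add: g_def delta_def)
    next
      case False
      then show ?thesis using outside[OF g False] xs xy by (auto simp: delta_def)
    qed
  qed
  have inj: "inj_on ?A (ell2 ?\<Lambda>)"
  proof (rule inj_onI)
    fix \<phi> \<psi> assume \<phi>: "\<phi> \<in> ell2 ?\<Lambda>" and \<psi>: "\<psi> \<in> ell2 ?\<Lambda>" and eq: "?A \<phi> = ?A \<psi>"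
    show "\<phi> = \<psi>"
    proof
      fix p show "\<phi> p = \<psi> p"
      proof (cases "p \<in> ?\<Lambda>")
        case True
        have "(\<Sum>q\<in>set xs. ?M p q * (\<phi> q - \<psi> q)) = 0" if "p \<in> set xs" for p
          using fun_cong[OF eq, of p] that xs hamiltonian_box_matrix[OF \<phi>] hamiltonian_box_matrix[OF \<psi>]
          by (simp add: right_diff_distrib sum_subtractf)
        then have "\<phi> p - \<psi> p = 0"
          using nondegenerateD[OF nd, of "\<lambda>q. \<phi> q - \<psi> q" p] True xs by simp
        then show ?thesis by simp
      next
        case False
        then show ?thesis using \<phi> \<psi> by (simp add: ell2_def)
      qed
    qed
  qed
  have "resolvent_on ?\<Lambda> (hamiltonian_box E r m0 w lam L) z (delta y) = g"
    unfolding resolvent_on_def by (rule inv_into_f_eq[OF inj g]) (rule Ag)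
  moreover have "ell2_inner (delta x) g = (\<Sum>\<^sub>\<infinity>p\<in>{x}. cnj (delta x p) * g p)"
    unfolding ell2_inner_def by (intro infsum_cong_neutral) (auto simp: delta_def)
  ultimately show ?thesis by (simp add: g_def delta_def)
qed

end

text \<open>The joint law of independent variables is the product of their laws. \<open>PiM\<close>
  lives on functions that are undefined off \<open>I\<close>, while the given family is indexed by
  all \<open>i\<close>; \<open>cong\<close> bridges the two.\<close>

lemma (in prob_space) nn_integral_indep_vars_PiM:
  assumes "finite I" "I \<noteq> {}" "indep_vars (\<lambda>_. borel) X I"
    and \<mu>: "\<And>i. i \<in> I \<Longrightarrow> distr M borel (X i) = \<mu>"
    and F: "F \<in> borel_measurable (PiM I (\<lambda>_. borel))"
    and cong: "\<And>w. F (restrict w I) = F w"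
  shows "(\<integral>\<^sup>+ \<omega>. F (\<lambda>i. X i \<omega>) \<partial>M) = (\<integral>\<^sup>+ w. F w \<partial>PiM I (\<lambda>_. \<mu>))"
proof -
  have rv: "random_variable borel (X i)" if "i \<in> I" for i
    using assms(3) that by (simp add: indep_vars_def)
  have meas: "(\<lambda>\<omega>. \<lambda>i\<in>I. X i \<omega>) \<in> measurable M (PiM I (\<lambda>_. borel))"
    by (intro measurable_restrict rv)
  have "(\<integral>\<^sup>+ \<omega>. F (\<lambda>i. X i \<omega>) \<partial>M) = (\<integral>\<^sup>+ \<omega>. F (\<lambda>i\<in>I. X i \<omega>) \<partial>M)"
    by (simp only: cong)
  also have "\<dots> = (\<integral>\<^sup>+ w. F w \<partial>distr M (PiM I (\<lambda>_. borel)) (\<lambda>\<omega>. \<lambda>i\<in>I. X i \<omega>))"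
    by (rule nn_integral_distr[symmetric, OF meas]) (use F in simp)
  also have "distr M (PiM I (\<lambda>_. borel)) (\<lambda>\<omega>. \<lambda>i\<in>I. X i \<omega>) = PiM I (\<lambda>i. distr M borel (X i))"
    using indep_vars_iff_distr_eq_PiM'[OF assms(2), of X "\<lambda>_. borel"] rv assms(3) by simp
  also have "\<dots> = PiM I (\<lambda>_. \<mu>)" by (intro PiM_cong \<mu> refl)
  finally show ?thesis .
qed

text \<open>Turns boundedness and compact support of \<rho> into the domination hypothesis
  \<open>dens\<close> of the averaging lemmas.\<close>

lemma nn_integral_bounded_density_le:
  fixes \<rho> :: "real \<Rightarrow> real" and f :: "real \<Rightarrow> ennreal"
  assumes \<rho>: "\<rho> \<in> borel_measurable lborel"
    and B: "AE t in lborel. \<bar>\<rho> t\<bar> \<le> D"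
    and S: "AE t in lborel. t \<notin> {-T..T} \<longrightarrow> \<rho> t = 0"
    and f: "f \<in> borel_measurable borel"
  shows "(\<integral>\<^sup>+ t. f t \<partial>density lborel (\<lambda>t. ennreal (\<rho> t)))
    \<le> ennreal D * (\<integral>\<^sup>+ t. f t * indicator {-T..T} t \<partial>lborel)"
proof -
  have [measurable]: "\<rho> \<in> borel_measurable borel" "f \<in> borel_measurable borel" using \<rho> f by auto
  have "(\<integral>\<^sup>+ t. f t \<partial>density lborel (\<lambda>t. ennreal (\<rho> t))) = (\<integral>\<^sup>+ t. ennreal (\<rho> t) * f t \<partial>lborel)"
    by (rule nn_integral_density) auto
  also have "\<dots> \<le> (\<integral>\<^sup>+ t. ennreal D * (f t * indicator {-T..T} t) \<partial>lborel)"
  proof (rule nn_integral_mono_AE)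
    show "AE t in lborel. ennreal (\<rho> t) * f t \<le> ennreal D * (f t * indicator {-T..T} t)"
      using B S
    proof eventually_elim
      case (elim t)
      show ?case
      proof (cases "t \<in> {-T..T}")
        case True
        have "ennreal (\<rho> t) \<le> ennreal D" using elim by (intro ennreal_leI) auto
        then show ?thesis using True by (simp add: mult_right_mono)
      qed (use elim in simp)
    qed
  qed
  also have "\<dots> = ennreal D * (\<integral>\<^sup>+ t. f t * indicator {-T..T} t \<partial>lborel)"
    by (rule nn_integral_cmult) measurable
  finally show ?thesis .
qed

theorem theorem1p1:
  fixes E :: "'v \<Rightarrow> 'v \<Rightarrow> bool" and r :: 'v and K m0 :: nat
    and M :: "'w measure" and \<omega> :: "'v \<Rightarrow> 'w \<Rightarrow> real" and \<rho> :: "real \<Rightarrow> real"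
    and s E0 \<gamma> :: real
  assumes "K \<ge> 2" and "m0 \<ge> 1"
    and "is_tree E" and "is_regular E (K + 1)"
    and "\<rho> \<in> borel_measurable lborel"
    and "AE t in lborel. 0 \<le> \<rho> t"
    and "\<exists>B. AE t in lborel. \<bar>\<rho> t\<bar> \<le> B"
    and "\<exists>S. compact S \<and> (AE t in lborel. t \<notin> S \<longrightarrow> \<rho> t = 0)"
    and "prob_space M"
    and "prob_space.indep_vars M (\<lambda>_. borel) \<omega> (J_set E r m0)"
    and "\<forall>y \<in> J_set E r m0. distributed M lborel (\<omega> y) (\<lambda>t. ennreal (\<rho> t))"
    and "0 < s" and "s < 1" and "0 < \<gamma>"
  shows "\<exists>lam0 > 0. \<exists>C > 0. \<forall>lam > lam0. \<forall>x y. \<forall>L. x \<in> Lambda_box E r L \<and> y \<in> Lambda_box E r L \<longrightarrow>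
    (SUP \<epsilon> \<in> {0<..}. \<integral>\<^sup>+ w. ennreal
        (cmod (ell2_inner (delta x)
          (resolvent_on (Lambda_box E r L) (hamiltonian_box E r m0 (\<lambda>v. \<omega> v w) lam L)
             (complex_of_real E0 + \<i> * complex_of_real \<epsilon>) (delta y))) powr s) \<partial>M)
      \<le> ennreal (C * exp (- \<gamma> * real (gdist E x y)))"
proof -
  interpret prob_space M by fact
  interpret connected_graph E "K + 1"
    using assms(3,4) by unfold_locales (auto simp: is_tree_def)
  let ?\<mu> = "density lborel (\<lambda>t. ennreal (\<rho> t))" and ?J = "J_set E r m0"
  obtain D0 where D0: "AE t in lborel. \<bar>\<rho> t\<bar> \<le> D0" using assms(7) by blast
  \<comment> \<open>The maximum supplies \<open>0 \<le> D\<close> without extracting it from the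
    almost everywhere bound.\<close>
  define D where "D = max D0 0"
  have D: "AE t in lborel. \<bar>\<rho> t\<bar> \<le> D" "0 \<le> D"
    using D0 by (auto simp: D_def elim!: eventually_mono)
  obtain S where S: "compact S" "AE t in lborel. t \<notin> S \<longrightarrow> \<rho> t = 0" using assms(8) by blast
  obtain T where T: "0 < T" "\<And>t. t \<in> S \<Longrightarrow> \<bar>t\<bar> \<le> T"
    using compact_imp_bounded[OF S(1)] by (auto simp: bounded_pos)
  have supp: "AE t in lborel. t \<notin> {-T..T} \<longrightarrow> \<rho> t = 0"
    using S(2) by eventually_elim (use T(2) in \<open>force simp: abs_le_iff\<close>)
  note dens = nn_integral_bounded_density_le[OF assms(5) D(1) supp]
  have distr: "distr M borel (\<omega> u) = ?\<mu>" if "u \<in> ?J" for u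
    using assms(11) that by (auto simp: distributed_def cong: distr_cong)
  have root: "r \<in> ?J" by (simp add: J_set_def)
  have \<mu>: "prob_space ?\<mu>"
    using assms(10) root unfolding distr[OF root, symmetric]
    by (intro prob_space_distr) (simp add: indep_vars_def)
  \<comment> \<open>The edge count of \<open>block_boundary\<close> for degree
    \<open>K + 1\<close>.\<close>
  define N where "N = (K + 2) ^ m0 * (K + 1)"
  have N: "1 \<le> N" by (simp add: N_def Suc_le_eq)
  \<comment> \<open>The factor to be gained per block, with diameter bound
    \<open>R = 2 * m0\<close>.\<close>
  define q where "q = exp (- \<gamma> * (real (2 * m0) + 1))"
  define A where "A = real N * (D * block_const s T) / q"
  have A: "0 \<le> A"
    using block_const_pos[OF assms(12,13) T(1)] D(2) by (simp add: A_def q_def)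
  \<comment> \<open>Solves \<open>A \<le> lam powr s\<close>, which is the condition
    \<open>large\<close>; adding 1 keeps \<open>lam0\<close> positive even if
    \<open>A = 0\<close>.\<close>
  define lam0 where "lam0 = (A + 1) powr (1 / s)"
  have lam0: "0 < lam0" using A by (simp add: lam0_def)
  have bound: "(\<integral>\<^sup>+ w. ennreal (cmod (ell2_inner (delta x)
          (resolvent_on (Lambda_box E r L) (hamiltonian_box E r m0 (\<lambda>v. \<omega> v w) lam L)
             (complex_of_real E0 + \<i> * complex_of_real \<epsilon>) (delta y))) powr s) \<partial>M)
      \<le> ennreal (exp (- \<gamma> * real (gdist E x y)))"
    if lam: "lam0 < lam" and xy: "x \<in> Lambda_box E r L" "y \<in> Lambda_box E r L" and \<epsilon>: "0 < \<epsilon>"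
    for lam x y L \<epsilon>
  proof -
    let ?\<Lambda> = "Lambda_box E r L"
    let ?I = "?J \<inter> ?\<Lambda>"
    let ?z = "complex_of_real E0 + \<i> * complex_of_real \<epsilon>"
    have fin: "finite ?\<Lambda>" using ball by (simp add: Lambda_box_def)
    obtain xs where xs: "distinct xs" "set xs = ?\<Lambda>" using finite_distinct_list[OF fin] by blast
    let ?G = "\<lambda>w. green (schrodinger E (block_potential ?I (block r m0) lam ?z w)) xs x y"
    have z: "0 < Im ?z" using \<epsilon> by simp
    have large: "real N * (D * block_const s T / lam powr s) \<le> exp (- \<gamma> * (real (2 * m0) + 1))"
    proof -
      have "A \<le> A + 1" by simp
      also have "A + 1 = lam0 powr s" using A assms(12) by (simp add: lam0_def powr_powr)
      also have "\<dots> \<le> lam powr s" using lam lam0 assms(12) by (intro powr_mono2) auto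
      finally have "real N * (D * block_const s T) \<le> q * lam powr s"
        unfolding A_def by (simp add: q_def field_simps)
      then show ?thesis using lam lam0 by (simp add: q_def field_simps)
    qed
    have "(\<integral>\<^sup>+ w. ennreal (cmod (ell2_inner (delta x)
          (resolvent_on ?\<Lambda> (hamiltonian_box E r m0 (\<lambda>v. \<omega> v w) lam L) ?z (delta y))) powr s) \<partial>M)
      = (\<integral>\<^sup>+ w. ennreal (cmod (?G (\<lambda>v. \<omega> v w)) powr s) \<partial>M)"
      using resolvent_eq_green[OF xs _ _ z] xy xs by simp
    also have "\<dots> = (\<integral>\<^sup>+ w. ennreal (cmod (?G w) powr s) \<partial>PiM ?I (\<lambda>_. ?\<mu>))"
    proof (rule nn_integral_indep_vars_PiM)
      \<comment> \<open>The root is a block centre and lies in every box.\<close>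
      show "?I \<noteq> {}" using root by (auto simp: Lambda_box_def)
      show "indep_vars (\<lambda>_. borel) \<omega> ?I" using assms(10) by (rule indep_vars_subset) auto
      have "?G \<in> borel_measurable (PiM ?I (\<lambda>_. borel))"
        by (rule measurable_green_block) (rule measurable_component_singleton)
      then show "(\<lambda>w. ennreal (cmod (?G w) powr s)) \<in> borel_measurable (PiM ?I (\<lambda>_. borel))"
        by measurable
      fix w
      have "block_potential ?I (block r m0) lam ?z (restrict w ?I) = block_potential ?I (block r m0) lam ?z w"
        by (simp add: block_potential_def fun_eq_iff)
      then show "ennreal (cmod (?G (restrict w ?I)) powr s) = ennreal (cmod (?G w) powr s)" by simp
    qed (use fin distr in auto)
    also have "\<dots> \<le> ennreal (exp (- \<gamma> * real (gdist E x y)))"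
    proof (rule green_block_fractional_moment_decay[OF \<mu> _ dens _ sym gdist_adj gdist_triangle
          block_dist block_boundary(1) _ _ z assms(12,13) T(1) D(2) _ _ large xs(1)])
      show "card {(b, a). b \<in> block r m0 u \<and> E b a} \<le> N" for u
        using block_boundary(2)[of r m0 u] by (simp add: N_def)
      show "\<exists>u\<in>?I. p \<in> block r m0 u" if "p \<in> set xs" for p
      proof -
        obtain u where u: "u \<in> ?J" "p \<in> block r m0 u" using ex_block by blast
        then have "u \<in> ?\<Lambda>" using that xs by (auto simp: block_def prec_def Lambda_box_def)
        then show ?thesis using u by blast
      qed
    qed (use fin lam lam0 assms(14) xy xs N in auto)
    finally show ?thesis .
  qed
  \<comment> \<open>The bound holds with \<open>C = 1\<close> for each \<epsilon> separately, hence
    for the supremum.\<close>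
  show ?thesis
    using lam0 bound by (intro exI[of _ lam0] conjI exI[of _ 1]) (auto intro!: SUP_least)
qed

end
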